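(* Let $k\geq 4$ be an even integer and let $M_k(z)=\sum_{n=1}^{\infty}r_ne^{2\pi i n z}$ be a cusp form of weight $k$ under $SL_2(\mathbb{Z})$. Put $M_{k,s}(x)=\sum_{n=1}^{\infty}\frac{r_n}{n^s}\sin(2\pi n x)$. Let $x\in\mathbb{R}\setminus\mathbb{Q}$ and let $\beta_{k,s}(x)$ be the H\"older regularity exponent of $M_{k,s}$ at $x$. Assume that $$s>\frac{k}{2}+1+\frac{2}{\nu(x)}-\frac{2}{\mu(x)}.$$ Then: (i) $\beta_{k,s}(x)\geq s-\frac{k}{2}-1+\frac{2}{\mu(x)}$; (ii) if moreover there exists $N\in\mathbb{N}$ such that $a_n(x)=N$ for infinitely many $n$, and $\mu(x)=2$, then $\beta_{k,s}(x)=s-\frac{k}{2}$.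
   Context: A modular form of weight $k$ under $SL_2(\mathbb{Z})$ is a holomorphic function $M_k$ on $\mathbb{H}=\{z\in\mathbb{C}:\mathrm{Im}(z)>0\}$ with $M_k\big(\frac{az+b}{cz+d}\big)=(cz+d)^kM_k(z)$ for all $\begin{pmatrix}a&b\\c&d\end{pmatrix}\in SL_2(\mathbb{Z})$, holomorphic at infinity, with Fourier expansion $\sum_{n\ge0}r_ne^{2\pi inz}$; it is a cusp form when $r_0=0$. For a cusp form, $M_{k,s}$ is well defined and continuous on $\mathbb{R}$ for $s>k/2$. H\"older regularity: for $f:\mathbb{R}\to\mathbb{R}$, $x_0\in\mathbb{R}$ and $\alpha>0$, $f\in C^{\alpha}(x_0)$ means there exist a polynomial $P$ of degree at most $[\alpha]$ and a constant $C$ with $|f(x)-P(x-x_0)|\leq C|x-x_0|^{\alpha}$ as $x\to x_0$; the H\"older regularity exponent of $f$ at $x_0$ is $\sup\{\beta: f\in C^{\beta}(x_0)\}$. For irrational $x=[a_0;a_1,a_2,\dots]$ (continued fraction, $a_n=a_n(x)$ the partial quotients) with convergents $\frac{p_n}{q_n}=[a_0;a_1,\dots,a_n]$, define $\kappa_n$ by $\big|x-\frac{p_n}{q_n}\big|=q_n^{-\kappa_n}$, and $\mu(x)=\limsup_{n}\kappa_n$, $\nu(x)=\liminf_{n}\kappa_n$, with the convention $\frac1\infty=0$.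
   Formalization: In (ii) the cusp form M_k is additionally assumed not to be identically zero; for the zero form M_{k,s} vanishes and its Hölder exponent is +∞, so (ii) fails as stated. *)

theory Defs
  imports "HOL-Complex_Analysis.Complex_Analysis"
begin

section \<open>Cusp forms for the full modular group\<close>

definition upper_half_plane :: "complex set" where
  "upper_half_plane = {z. Im z > 0}"

text \<open>A 1-periodic function on the upper half plane is a function of \<open>q = exp (2 \<pi> i z)\<close>;
  it is holomorphic at infinity if that function extends holomorphically to \<open>q = 0\<close>.\<close>

definition holomorphic_at_infinity :: "(complex \<Rightarrow> complex) \<Rightarrow> bool" where
  "holomorphic_at_infinity M \<longleftrightarrow>
     (\<exists>g. g holomorphic_on ball 0 1 \<and>
          (\<forall>z\<in>upper_half_plane. M z = g (exp (2 * of_real pi * \<i> * z))))"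

definition modular_form :: "nat \<Rightarrow> (complex \<Rightarrow> complex) \<Rightarrow> bool" where
  "modular_form k M \<longleftrightarrow>
     M holomorphic_on upper_half_plane \<and>
     (\<forall>a b c d :: int. a * d - b * c = 1 \<longrightarrow>
        (\<forall>z\<in>upper_half_plane.
           M ((of_int a * z + of_int b) / (of_int c * z + of_int d)) =
             (of_int c * z + of_int d) ^ k * M z)) \<and>
     holomorphic_at_infinity M"

definition has_fourier_expansion :: "(complex \<Rightarrow> complex) \<Rightarrow> (nat \<Rightarrow> complex) \<Rightarrow> bool" where
  "has_fourier_expansion M r \<longleftrightarrow>
     (\<forall>z\<in>upper_half_plane. (\<lambda>n. r n * exp (2 * of_real pi * \<i> * of_nat n * z)) sums M z)"

definition cusp_form :: "nat \<Rightarrow> (complex \<Rightarrow> complex) \<Rightarrow> (nat \<Rightarrow> complex) \<Rightarrow> bool" where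
  "cusp_form k M r \<longleftrightarrow> modular_form k M \<and> has_fourier_expansion M r \<and> r 0 = 0"

text \<open>The series \<open>M\<^sub>k\<^sub>,\<^sub>s\<close>, summed over \<open>n \<ge> 1\<close>. It depends on the form only through its Fourier
  coefficients, and is complex-valued because these may be complex.\<close>

definition sine_series :: "(nat \<Rightarrow> complex) \<Rightarrow> real \<Rightarrow> real \<Rightarrow> complex" where
  "sine_series r s x =
     (\<Sum>n. r (Suc n) / of_real (real (Suc n) powr s) *
           of_real (sin (2 * pi * real (Suc n) * x)))"


section \<open>Pointwise Hoelder regularity\<close>

text \<open>The codomain is left generic so that the notion covers both real- and complex-valued
  functions; the polynomial has coefficients in the codomain.\<close>

definition hoelder_at :: "real \<Rightarrow> (real \<Rightarrow> 'a::real_normed_field) \<Rightarrow> real \<Rightarrow> bool" where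
  "hoelder_at \<alpha> f x0 \<longleftrightarrow>
     (\<exists>(P :: 'a poly) C. degree P \<le> nat \<lfloor>\<alpha>\<rfloor> \<and>
        (\<forall>\<^sub>F t in at x0. norm (f t - poly P (of_real (t - x0))) \<le> C * \<bar>t - x0\<bar> powr \<alpha>))"

definition hoelder_exponent :: "(real \<Rightarrow> 'a::real_normed_field) \<Rightarrow> real \<Rightarrow> ereal" where
  "hoelder_exponent f x0 = Sup {ereal \<beta> | \<beta>. \<beta> > 0 \<and> hoelder_at \<beta> f x0}"


section \<open>Continued fractions and approximation exponents\<close>

primrec complete_quotient :: "real \<Rightarrow> nat \<Rightarrow> real" where
  "complete_quotient x 0 = x"
| "complete_quotient x (Suc n) = 1 / frac (complete_quotient x n)"

definition partial_quotient :: "real \<Rightarrow> nat \<Rightarrow> int" where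
  "partial_quotient x n = \<lfloor>complete_quotient x n\<rfloor>"

text \<open>The value of the finite continued fraction \<open>[a\<^sub>0; a\<^sub>1, \<dots>, a\<^sub>n]\<close>. The empty list only
  serves as a terminator: since \<open>1 / 0 = 0\<close>, the value of \<open>[a]\<close> is \<open>a\<close>.\<close>

primrec cf_value :: "int list \<Rightarrow> rat" where
  "cf_value [] = 0"
| "cf_value (a # as) = of_int a + 1 / cf_value as"

definition convergent_cf :: "real \<Rightarrow> nat \<Rightarrow> rat" where
  "convergent_cf x n = cf_value (map (partial_quotient x) [0..<Suc n])"

text \<open>The denominator of the convergent in lowest terms (and positive).\<close>

definition convergent_denom :: "real \<Rightarrow> nat \<Rightarrow> int" where
  "convergent_denom x n = snd (quotient_of (convergent_cf x n))"

text \<open>The solution \<open>\<kappa>\<close> of \<open>\<bar>x - p\<^sub>n / q\<^sub>n\<bar> = q\<^sub>n powr (- \<kappa>)\<close>. For irrational \<open>x\<close> it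
  exists and is unique as soon as \<open>q\<^sub>n > 1\<close>, i.e. for all \<open>n \<ge> 2\<close>; the junk values for
  smaller \<open>n\<close> do not affect the limits below.\<close>

definition approx_exponent :: "real \<Rightarrow> nat \<Rightarrow> real" where
  "approx_exponent x n =
     - log (of_int (convergent_denom x n)) \<bar>x - of_rat (convergent_cf x n)\<bar>"

definition mu_exponent :: "real \<Rightarrow> ereal" where
  "mu_exponent x = limsup (\<lambda>n. ereal (approx_exponent x n))"

definition nu_exponent :: "real \<Rightarrow> ereal" where
  "nu_exponent x = liminf (\<lambda>n. ereal (approx_exponent x n))"

end

theory Submission imports Defs begin

text \<open>Write \<open>\<kappa> = k / 2\<close>. By modularity \<open>Im z powr \<kappa> * norm (M z)\<close> is bounded, and
  \<open>F t = (\<Sum>n. r n / n powr s * exp (2 * pi * \<i> * n * t))\<close> is, up to a constant, the integral of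
  \<open>u powr (s - 1) * M (t + \<i> * u)\<close> over \<open>u > 0\<close>. Expanding the integrand in Taylor polynomials along
  horizontal lines shows that \<open>F\<close> has regularity at least \<open>s - \<kappa>\<close> at every point; as \<open>mu_exponent x \<ge> 2\<close>,
  this is at least as strong as the bound in (i).

  For the converse, \<open>M z\<close> is recovered by integrating the sine series against
  \<open>\<Sum>n. n powr s * exp (2 * pi * \<i> * n * (z - t))\<close>, which is of size \<open>norm (z - t) powr (- s - 1)\<close> and
  annihilates both the frequencies \<open>- n\<close> of the sine series and any polynomial in
  \<open>exp (- 2 * pi * \<i> * t)\<close>. Regularity above \<open>s - \<kappa>\<close> at \<open>x\<close> would therefore force
  \<open>Im z powr \<kappa> * norm (M z)\<close> to tend to \<open>0\<close> in every cone with vertex \<open>x\<close>. Good rational approximations of an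
  irrational \<open>x\<close> yield, for each \<open>w\<close>, modular images of \<open>w\<close> that tend to \<open>x\<close> inside such a cone; as the
  function is invariant, \<open>M w = 0\<close>.\<close>

section \<open>Approximation exponents of continued fractions\<close>

text \<open>The hypothesis on \<open>s\<close> gives \<open>s > k / 2 + 1\<close>, because
  \<open>nu_exponent x\<close> is at most \<open>mu_exponent x\<close>. With Hecke's bound, which
  makes \<open>r n\<close> of order at most \<open>n powr (k / 2)\<close>, the sine series then
  converges absolutely. The obstacle in the converse is that regularity of the sine series does not
  obviously pass to \<open>F\<close>: the irregularities of \<open>F t\<close> and
  \<open>F (- t)\<close> might cancel. The argument therefore keeps the sine series and uses a
  kernel with positive frequencies only. This one-sidedness also decides how the Hoelder polynomial
  is treated: it is not periodic, and it is replaced by a polynomial in one exponential, all of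
  whose frequencies have the harmless sign. As \<open>s\<close> need not be an integer, the kernel
  need not be a rational function of \<open>exp (2 * pi * i * z)\<close>; its size comes from an
  integer order by fractional integration. Cones enter because for \<open>z\<close> in a cone at
  \<open>x\<close> the distance from \<open>t\<close> to \<open>x\<close> is at most a constant
  times \<open>norm (z - t)\<close>, so the Hoelder bound and the kernel bound are powers of one
  quantity. Nonvanishing of \<open>M\<close> in (ii) excludes the zero form, whose sine series has
  infinite exponent.\<close>

lemma irrational_inverse_frac:
  assumes "x \<notin> \<rat>"
  shows "1 / frac x \<notin> \<rat>" "1 / frac x > 1"
proof -
  have "frac x \<notin> \<rat>"
    using assms by (metis Rats_add Rats_of_int add.commute diff_add_cancel frac_def)
  then show "1 / frac x \<notin> \<rat>"
    by (metis Rats_inverse inverse_eq_divide inverse_inverse_eq)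
  have "frac x > 0"
    using assms by (metis Ints_subset_Rats frac_gt_0_iff subsetD)
  then show "1 / frac x > 1"
    using frac_lt_1[of x] by simp
qed

text \<open>The defining recursion adds a step at the end of the expansion, whereas
  \<open>cf_value\<close> unfolds at its head. This shift lets an induction replace \<open>x\<close>
  by its first complete quotient.\<close>

lemma complete_quotient_Suc': "complete_quotient x (Suc n) = complete_quotient (1 / frac x) n"
  by (induction n) auto

lemma convergent_cf_Suc:
  "convergent_cf x (Suc n) = of_int \<lfloor>x\<rfloor> + 1 / convergent_cf (1 / frac x) n"
proof -
  have "map (partial_quotient x) [0..<Suc (Suc n)]
      = partial_quotient x 0 # map (\<lambda>i. partial_quotient x (Suc i)) [0..<Suc n]"
    by (simp add: map_Suc_upt[symmetric] upt_conv_Cons del: upt_Suc)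
  moreover have "(\<lambda>i. partial_quotient x (Suc i)) = partial_quotient (1 / frac x)"
    unfolding partial_quotient_def complete_quotient_Suc' ..
  moreover have "partial_quotient x 0 = \<lfloor>x\<rfloor>"
    by (simp add: partial_quotient_def)
  ultimately show ?thesis
    unfolding convergent_cf_def by (simp del: upt_Suc)
qed

text \<open>Each continued fraction step is an integer Moebius map of determinant -1, so
  \<open>x\<close> is the image of the complete quotient \<open>\<xi>\<close> of index
  \<open>n + 1\<close> under an integer matrix with columns \<open>(p, q)\<close> and
  \<open>(p', q')\<close>. The claims about \<open>p\<close> for \<open>x > 1\<close> carry the
  induction: the numerators for \<open>1 / frac x\<close> become the denominators for
  \<open>x\<close>.\<close>

lemma convergent_cf_moebius:
  assumes "x \<notin> \<rat>"
  shows "\<exists>(p::int) (p'::int) (q::int) (q'::int) (\<xi>::real). convergent_cf x n = of_int p / of_int q \<and> coprime p q \<and>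
     \<bar>p * q' - p' * q\<bar> = 1 \<and> x * (q * \<xi> + q') = p * \<xi> + p' \<and> \<xi> > 1 \<and> 0 < q \<and> 0 \<le> q' \<and> q' \<le> q \<and>
     (x > 1 \<longrightarrow> 0 < p \<and> 0 \<le> p' \<and> p' \<le> p) \<and> (n \<ge> 2 \<longrightarrow> q \<ge> 2) \<and> (x > 1 \<and> n \<ge> 1 \<longrightarrow> p \<ge> 2)"
  using assms
proof (induction n arbitrary: x)
  case 0
  let ?a = "\<lfloor>x\<rfloor>" and ?\<xi> = "1 / frac x"
  have "?\<xi> > 1"
    using irrational_inverse_frac[OF 0] by auto
  moreover from this have "frac x > 0"
    using frac_ge_0[of x] by (cases "frac x = 0") auto
  moreover have "x * ?\<xi> = ?a * ?\<xi> + 1"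
    using \<open>frac x > 0\<close> by (simp add: field_simps frac_def)
  moreover have "convergent_cf x 0 = of_int ?a / of_int 1"
    by (simp add: convergent_cf_def partial_quotient_def)
  ultimately show ?case
    \<comment> \<open>The second column \<open>(1, 0)\<close> is the usual formal convergent
      preceding the first one.\<close>
    by (intro exI[of _ ?a] exI[of _ 1] exI[of _ 1] exI[of _ 0] exI[of _ ?\<xi>]) auto
next
  case (Suc n)
  let ?a = "\<lfloor>x\<rfloor>" and ?y = "1 / frac x"
  have y: "?y \<notin> \<rat>" "?y > 1"
    using irrational_inverse_frac[OF Suc.prems] by auto
  obtain p p' q q' :: int and \<xi> :: real where
    *: "convergent_cf ?y n = of_int p / of_int q" "coprime p q" "\<bar>p * q' - p' * q\<bar> = 1"
      "?y * (q * \<xi> + q') = p * \<xi> + p'" "\<xi> > 1" "0 < q" "0 \<le> q'" "q' \<le> q"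
      "0 < p" "0 \<le> p'" "p' \<le> p" "n \<ge> 2 \<longrightarrow> q \<ge> 2" "n \<ge> 1 \<longrightarrow> p \<ge> 2"
    using Suc.IH[OF y(1)] y(2) by blast
  have "frac x > 0"
    using y(2) frac_ge_0[of x] by (cases "frac x = 0") auto
  have x_eq: "x = ?a + frac x"
    by (simp add: frac_def)
  have A: "frac x * (p * \<xi> + p') = q * \<xi> + q'"
    using *(4) \<open>frac x > 0\<close> by (simp add: field_simps)
  have B: "x * (p * \<xi> + p') = (?a * p + q) * \<xi> + (?a * p' + q')"
    using arg_cong[OF x_eq, of "\<lambda>t. t * (p * \<xi> + p')"] A by (simp add: algebra_simps)
  have C: "convergent_cf x (Suc n) = of_int (?a * p + q) / of_int p"
    unfolding convergent_cf_Suc *(1) using *(6,9) by (simp add: field_simps)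
  have D: "coprime (?a * p + q) p"
    using *(2) by (metis add.commute coprime_commute coprime_iff_gcd_eq_1 gcd_add_mult mult.commute)
  have E: "\<bar>(?a * p + q) * p' - (?a * p' + q') * p\<bar> = 1"
    using *(3) by (simp add: algebra_simps abs_minus_commute)
  have F: "0 < ?a * p + q \<and> 0 \<le> ?a * p' + q' \<and> ?a * p' + q' \<le> ?a * p + q \<and> ?a * p + q \<ge> 2" if "x > 1"
  proof -
    have a: "?a \<ge> 1" using that by linarith
    have "?a * p' \<ge> 0" "?a * p' \<le> ?a * p" "1 * 1 \<le> ?a * p"
      using a * by (intro mult_nonneg_nonneg mult_left_mono mult_mono; linarith)+
    then show ?thesis using * by linarith
  qed
  show ?case
    by (rule exI[of _ "?a * p + q"], rule exI[of _ "?a * p' + q'"], rule exI[of _ p], rule exI[of _ p'],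
        rule exI[of _ \<xi>]) (use B C D E F * in auto)
qed

text \<open>The determinant identity turns the Moebius relation into
  \<open>\<bar>x * q - p\<bar> * (q * \<xi> + q') = 1\<close>, and the second factor is at least
  \<open>q\<close>, so the error is at most \<open>1 / q^2\<close>. For \<open>n \<ge> 2\<close> the
  base \<open>q\<close> of the logarithm is at least 2, which makes it increasing.\<close>

lemma approx_exponent_ge_2:
  assumes "x \<notin> \<rat>" "n \<ge> 2"
  shows "approx_exponent x n \<ge> 2"
proof -
  obtain p p' q q' :: int and \<xi> :: real where
    *: "convergent_cf x n = of_int p / of_int q" "coprime p q" "\<bar>p * q' - p' * q\<bar> = 1"
      "x * (q * \<xi> + q') = p * \<xi> + p'" "\<xi> > 1" "0 < q" "0 \<le> q'" "q' \<le> q" "n \<ge> 2 \<longrightarrow> q \<ge> 2"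
    using convergent_cf_moebius[OF assms(1), of n] by blast
  have q2: "q \<ge> 2" using * assms by simp
  have "quotient_of (convergent_cf x n) = (p, q)"
    using * by (simp add: Fract_of_int_quotient[symmetric] quotient_of_Fract normalize_stable)
  then have den: "convergent_denom x n = q"
    by (simp add: convergent_denom_def)
  have pos: "q * \<xi> + q' \<ge> q"
  proof -
    have "real_of_int q * 1 \<le> q * \<xi>"
      using * by (intro mult_left_mono) auto
    moreover have "0 \<le> real_of_int q'"
      using * by simp
    ultimately show ?thesis by linarith
  qed
  have "(x * q - p) * (q * \<xi> + q') = q * (x * (q * \<xi> + q')) - p * (q * \<xi> + q')"
    by (simp add: algebra_simps)
  also have "\<dots> = real_of_int (p' * q - p * q')"
    unfolding *(4) by (simp add: algebra_simps)
  finally have "\<bar>x * q - p\<bar> * \<bar>q * \<xi> + q'\<bar> = real_of_int \<bar>p' * q - p * q'\<bar>"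
    by (simp add: abs_mult[symmetric])
  moreover have "\<bar>p' * q - p * q'\<bar> = 1"
    using *(3) by (simp add: abs_minus_commute)
  ultimately have 1: "\<bar>x * q - p\<bar> * (q * \<xi> + q') = 1"
    using pos q2 by simp
  have "\<bar>x * q - p\<bar> * q \<le> \<bar>x * q - p\<bar> * (q * \<xi> + q')"
    by (intro mult_left_mono pos) auto
  with 1 have 2: "\<bar>x * q - p\<bar> * q \<le> 1" by simp
  have eq: "x - of_rat (convergent_cf x n) = (x * q - p) / q"
    using q2 by (simp add: *(1) of_rat_divide field_simps)
  have "\<bar>x - of_rat (convergent_cf x n)\<bar> = \<bar>x * q - p\<bar> * q / q^2"
    using q2 unfolding eq by (simp add: power2_eq_square abs_mult)
  also have "\<dots> \<le> 1 / q^2"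
    using 2 by (intro divide_right_mono) auto
  finally have le: "\<bar>x - of_rat (convergent_cf x n)\<bar> \<le> 1 / q^2" .
  have ne: "\<bar>x - of_rat (convergent_cf x n)\<bar> > 0"
    using assms(1) Rats_of_rat by (metis eq_iff_diff_eq_0 zero_less_abs_iff)
  have "log q \<bar>x - of_rat (convergent_cf x n)\<bar> \<le> log q (1 / q^2)"
    using le ne q2 by (intro log_mono) auto
  also have "\<dots> = -2"
    using q2 by (simp add: log_divide log_nat_power)
  finally show ?thesis
    by (simp add: approx_exponent_def den)
qed

lemma nu_mu_exponent:
  assumes "x \<notin> \<rat>"
  shows "2 \<le> nu_exponent x" "nu_exponent x \<le> mu_exponent x"
proof -
  have "\<forall>\<^sub>F n in sequentially. (2::ereal) \<le> ereal (approx_exponent x n)"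
    using approx_exponent_ge_2[OF assms] by (intro eventually_sequentiallyI[of 2]) auto
  then show "2 \<le> nu_exponent x"
    unfolding nu_exponent_def by (rule Liminf_bounded)
  show "nu_exponent x \<le> mu_exponent x"
    unfolding nu_exponent_def mu_exponent_def by (intro Liminf_le_Limsup) auto
qed

lemma ereal_two_divide:
  fixes a :: ereal
  assumes "2 \<le> a"
  obtains c where "2 / a = ereal c" "0 \<le> c" "c \<le> 1"
  using assms by (cases a) auto

lemma ereal_two_divide_antimono:
  fixes a b :: ereal
  assumes "2 \<le> a" "a \<le> b"
  shows "2 / b \<le> 2 / a"
  using assms by (cases a; cases b) (auto simp: field_simps)

section \<open>Gamma integrals of exponential series\<close>

lemma powr_mult_exp_bounded:
  fixes p c :: real
  assumes "p \<ge> 0" "c > 0"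
  obtains C where "C > 0" "\<And>y. y > 0 \<Longrightarrow> y powr p * exp (- c * y) \<le> C"
proof (cases "p = 0")
  case True
  then show ?thesis using that[of 1] assms by auto
next
  case False
  with assms have p: "p > 0" by simp
  show ?thesis
  \<comment> \<open>This is the maximum of the function, attained at \<open>y = p / c\<close>. The
    inequality \<open>ln a \<le> a - 1\<close> at \<open>a = c * y / p\<close> proves it without
    calculus.\<close>
  proof (rule that[of "exp (p * ln (p / c) - p)"])
    fix y :: real assume y: "y > 0"
    have "ln (c * y / p) \<le> c * y / p - 1"
      using y p assms by (intro ln_le_minus_one) auto
    then have "p * ln (c * y / p) \<le> c * y - p"
      using p by (simp add: field_simps)
    then have "p * ln y - c * y \<le> p * ln (p / c) - p"
      using y p assms by (simp add: ln_mult ln_div algebra_simps)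
    then show "y powr p * exp (- c * y) \<le> exp (p * ln (p / c) - p)"
      using y by (simp add: powr_def exp_add[symmetric])
  qed auto
qed

lemma has_bochner_integral_Gamma:
  fixes p c :: real
  assumes "p > 0" "c > 0"
  shows "has_bochner_integral (lebesgue_on {0<..}) (\<lambda>u. u powr (p - 1) * exp (- c * u)) (Gamma p / c powr p)"
proof -
  let ?g = "\<lambda>u::real. indicator {0<..} u *\<^sub>R (u powr (p - 1) * exp (- u))"
  have "(\<lambda>t. t powr (p - 1) / exp t) absolutely_integrable_on {0..}"
    using Gamma_integral_real[OF assms(1)]
    by (intro nonnegative_absolutely_integrable_1) (auto simp: integrable_on_def)
  then have "has_bochner_integral (lebesgue_on {0..}) (\<lambda>t. t powr (p - 1) / exp t) (Gamma p)"
    using Gamma_integral_real[OF assms(1)]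
    by (simp add: has_bochner_integral_iff lebesgue_integral_eq_integral integral_unique
        integrable_restrict_space set_integrable_def)
  then have "has_bochner_integral lebesgue (\<lambda>t. indicator {0..} t *\<^sub>R (t powr (p - 1) / exp t)) (Gamma p)"
    by (subst (asm) has_bochner_integral_restrict_space) auto
  moreover have "(\<lambda>t::real. indicator {0..} t *\<^sub>R (t powr (p - 1) / exp t)) = ?g"
    by (auto simp: indicator_def exp_minus field_simps fun_eq_iff)
  ultimately have "has_bochner_integral lebesgue ?g (Gamma p)"
    by simp
  then have "has_bochner_integral lebesgue (\<lambda>u. ?g (0 + c * u)) (Gamma p /\<^sub>R \<bar>c\<bar>)"
    using assms by (subst (asm) has_bochner_integral_lebesgue_real_affine_iff[of c _ _ 0]) auto
  then have "has_bochner_integral lebesgue (\<lambda>u. c powr (1 - p) * ?g (0 + c * u)) (c powr (1 - p) * (Gamma p /\<^sub>R \<bar>c\<bar>))"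
    by (intro has_bochner_integral_mult_right) auto
  moreover have "(\<lambda>u. c powr (1 - p) * ?g (0 + c * u)) = (\<lambda>u. indicator {0<..} u *\<^sub>R (u powr (p - 1) * exp (- c * u)))"
  proof
    fix u :: real
    show "c powr (1 - p) * ?g (0 + c * u) = indicator {0<..} u *\<^sub>R (u powr (p - 1) * exp (- c * u))"
      using assms by (auto simp: indicator_def powr_mult zero_less_mult_iff powr_add[symmetric])
  qed
  moreover have "c powr (1 - p) * (Gamma p /\<^sub>R \<bar>c\<bar>) = Gamma p / c powr p"
    using assms by (simp add: powr_diff field_simps)
  ultimately show ?thesis
    by (subst has_bochner_integral_restrict_space) auto
qed

text \<open>Termwise integration is legitimate because the integrals of the norms of the terms are a
  constant multiple of the assumed summable series. It serves twice: with the coefficients of the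
  form, and with powers \<open>n ^ L\<close> to build the kernel.\<close>

lemma has_bochner_integral_Gamma_series:
  fixes a :: "nat \<Rightarrow> complex" and p :: real
  assumes p: "p > 0"
    and summable: "summable (\<lambda>n. norm (a n) / real (Suc n) powr p)"
    and A: "\<And>u. u > 0 \<Longrightarrow> (\<lambda>n. a n * of_real (exp (- 2 * pi * real (Suc n) * u))) sums A u"
  shows "has_bochner_integral (lebesgue_on {0<..}) (\<lambda>u. of_real (u powr (p - 1)) * A u)
     (of_real (Gamma p / (2 * pi) powr p) * (\<Sum>n. a n / of_real (real (Suc n) powr p)))"
proof -
  let ?L = "lebesgue_on {0::real<..}"
  define f where "f n u = a n * of_real (u powr (p - 1) * exp (- (2 * pi * real (Suc n)) * u))" for n u
  have hbi: "has_bochner_integral ?L (f n) (a n * of_real (Gamma p / (2 * pi * real (Suc n)) powr p))" for n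
    unfolding f_def using has_bochner_integral_Gamma[OF p, of "2 * pi * real (Suc n)"]
    by (intro has_bochner_integral_mult_right has_bochner_integral_of_real) auto
  have norm_f: "norm (f n u) = norm (a n) * (u powr (p - 1) * exp (- (2 * pi * real (Suc n)) * u))" for n u
    by (simp add: f_def norm_mult)
  have int_norm: "(\<integral>u. norm (f n u) \<partial>?L) = norm (a n) * (Gamma p / (2 * pi * real (Suc n)) powr p)" for n
    unfolding norm_f using has_bochner_integral_Gamma[OF p, of "2 * pi * real (Suc n)"]
    by (intro has_bochner_integral_integral_eq has_bochner_integral_mult_right) auto
  have split: "Gamma p / (2 * pi * real (Suc n)) powr p = Gamma p / (2 * pi) powr p * (1 / real (Suc n) powr p)" for n
    by (simp add: powr_mult)
  have sum_norm: "summable (\<lambda>n. \<integral>u. norm (f n u) \<partial>?L)"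
    unfolding int_norm split using summable_mult[OF summable, of "Gamma p / (2 * pi) powr p"]
    by (simp add: field_simps)
  \<comment> \<open>The hypothesis on \<open>A\<close> gives convergence but not absolute
    convergence at \<open>u\<close>. The latter follows since the exponential is at most a constant,
    depending on \<open>u\<close>, times \<open>real (Suc n) powr (- p)\<close>.\<close>
  have sum_pt: "summable (\<lambda>n. norm (f n u))" if "u > 0" for u
  proof -
    obtain C where C: "C > 0" "\<And>y. y > 0 \<Longrightarrow> y powr p * exp (- (2 * pi * u) * y) \<le> C"
      using powr_mult_exp_bounded[of p "2 * pi * u"] p \<open>u > 0\<close> by auto
    show ?thesis
    proof (rule summable_comparison_test')
      show "summable (\<lambda>n. u powr (p - 1) * C * (norm (a n) / real (Suc n) powr p))"
        by (intro summable_mult summable)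
      fix n :: nat assume "n \<ge> 0"
      have "exp (- (2 * pi * u) * real (Suc n)) \<le> C / real (Suc n) powr p"
        using C(2)[of "real (Suc n)"] by (simp add: field_simps)
      then have "norm (a n) * u powr (p - 1) * exp (- (2 * pi * u) * real (Suc n))
         \<le> norm (a n) * u powr (p - 1) * (C / real (Suc n) powr p)"
        by (intro mult_left_mono) auto
      then show "norm (norm (f n u)) \<le> u powr (p - 1) * C * (norm (a n) / real (Suc n) powr p)"
        unfolding norm_f by (simp add: algebra_simps)
    qed
  qed
  have f_sums: "(\<Sum>n. f n u) = of_real (u powr (p - 1)) * A u" if "u > 0" for u
  proof -
    have "(\<lambda>n. of_real (u powr (p - 1)) * (a n * of_real (exp (- 2 * pi * real (Suc n) * u)))) sums
        (of_real (u powr (p - 1)) * A u)"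
      by (intro sums_mult A that)
    then show ?thesis
      by (intro sums_unique[symmetric]) (simp add: f_def algebra_simps)
  qed
  have f_int: "integrable ?L (f n)" for n
    using hbi by (auto simp: has_bochner_integral_iff)
  have AE: "AE u in ?L. summable (\<lambda>n. norm (f n u))"
    by (intro AE_I2) (auto simp: sum_pt)
  have sums1: "(\<lambda>n. integral\<^sup>L ?L (f n)) sums (\<integral>u. (\<Sum>n. f n u) \<partial>?L)"
    by (rule sums_integral[OF f_int AE sum_norm])
  have int1: "integrable ?L (\<lambda>u. \<Sum>n. f n u)"
    by (rule integrable_suminf[OF f_int AE sum_norm])
  have "integral\<^sup>L ?L (f n) = of_real (Gamma p / (2 * pi) powr p) * (a n / of_real (real (Suc n) powr p))" for n
    using has_bochner_integral_integral_eq[OF hbi[of n]] by (simp add: powr_mult)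
  with sums1 have s: "(\<lambda>n. of_real (Gamma p / (2 * pi) powr p) * (a n / of_real (real (Suc n) powr p))) sums
      (\<integral>u. (\<Sum>n. f n u) \<partial>?L)" by simp
  have "summable (\<lambda>n. a n / of_real (real (Suc n) powr p))"
    by (rule summable_norm_cancel) (use summable in \<open>simp add: norm_divide\<close>)
  then have "(\<integral>u. (\<Sum>n. f n u) \<partial>?L) = of_real (Gamma p / (2 * pi) powr p) * (\<Sum>n. a n / of_real (real (Suc n) powr p))"
    by (intro sums_unique2[OF s] sums_mult summable_sums)
  with int1 have "has_bochner_integral ?L (\<lambda>u. \<Sum>n. f n u)
     (of_real (Gamma p / (2 * pi) powr p) * (\<Sum>n. a n / of_real (real (Suc n) powr p)))"
    by (simp add: has_bochner_integral_iff)
  then show ?thesis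
    by (rule has_bochner_integral_cong[THEN iffD1, rotated -1]) (auto simp: f_sums)
qed

section \<open>Growth of cusp forms and of their coefficients\<close>

lemma moebius_upper_half_plane:
  fixes a b c d :: int
  assumes "a * d - b * c = 1" "z \<in> upper_half_plane"
  shows "of_int c * z + of_int d \<noteq> 0"
    and "Im ((of_int a * z + of_int b) / (of_int c * z + of_int d)) = Im z / (norm (of_int c * z + of_int d))\<^sup>2"
    and "(of_int a * z + of_int b) / (of_int c * z + of_int d) \<in> upper_half_plane"
proof -
  have z: "Im z > 0" using assms by (simp add: upper_half_plane_def)
  show ne: "of_int c * z + of_int d \<noteq> 0"
  proof
    assume eq: "of_int c * z + of_int d = 0"
    then have "Im (of_int c * z + of_int d) = 0" by simp
    with z have "c = 0" by simp
    with eq have "d = 0" by simp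
    with \<open>c = 0\<close> assms show False by simp
  qed
  have "(of_int a * d - b * c :: real) = 1"
    using arg_cong[OF assms(1), of real_of_int] by simp
  then have det: "Im z * (of_int a * d - b * c) = Im z" by simp
  have "Im (of_int a * z + of_int b) * Re (of_int c * z + of_int d)
      - Re (of_int a * z + of_int b) * Im (of_int c * z + of_int d) = Im z * (of_int a * d - b * c)"
    by (simp add: ring_distribs)
  then show eq: "Im ((of_int a * z + of_int b) / (of_int c * z + of_int d)) = Im z / (norm (of_int c * z + of_int d))\<^sup>2"
    unfolding Im_divide cmod_power2 by (simp only: det)
  show "(of_int a * z + of_int b) / (of_int c * z + of_int d) \<in> upper_half_plane"
    unfolding upper_half_plane_def mem_Collect_eq eq using z ne
    by (intro divide_pos_pos) (simp_all only: zero_less_power2 zero_less_norm_iff norm_eq_zero not_False_eq_True)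
qed

text \<open>The image has height \<open>Im z / (norm (c * z + d))\<^sup>2\<close>, so it suffices to
  find coprime \<open>c\<close>, \<open>d\<close> with squared norm at most \<open>4 * Im z\<close>.
  Dirichlet approximation of \<open>Re z\<close> provides them and takes the place of reduction to a
  fundamental domain.\<close>

lemma moebius_Im_ge_quarter:
  assumes "z \<in> upper_half_plane"
  obtains a b c d :: int where "a * d - b * c = 1"
    "Im ((of_int a * z + of_int b) / (of_int c * z + of_int d)) \<ge> 1 / 4"
proof (cases "Im z \<ge> 1 / 4")
  case True
  then show ?thesis using that[of 1 1 0 0] by simp
next
  case False
  define y where "y = Im z"
  define t where "t = sqrt y"
  have y: "0 < y" "y < 1 / 4"
    using assms False by (auto simp: y_def upper_half_plane_def)
  have t: "0 < t" "t * t = y" using y by (auto simp: t_def)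
  have t2: "t < 1 / 2"
    unfolding t_def using y(2) by (intro real_less_lsqrt) (auto simp: power2_eq_square)
  \<comment> \<open>This \<open>N\<close> balances the two coordinates of \<open>k * z - h\<close>:
    the real part is below \<open>1 / N \<le> t\<close>, the imaginary part at most
    \<open>N * t\<^sup>2 \<le> 3 / 2 * t\<close>. The squares add up to \<open>13 / 4 * y\<close>,
    rounded up to \<open>4 * y\<close>.\<close>
  define N where "N = nat \<lceil>1 / t\<rceil>"
  have N: "1 / t \<le> real N" "real N \<le> 1 / t + 1" "N > 0"
    using t(1) unfolding N_def by (auto simp: of_nat_nat zero_less_ceiling)
  then have Nt: "1 \<le> real N * t" "real N * t \<le> 1 + t"
    using t(1) by (auto simp: field_simps)
  obtain h k :: int where hk: "coprime h k" "0 < k" "k \<le> int N" "\<bar>of_int k * Re z - of_int h\<bar> < 1 / N"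
    using Dirichlet_approx_coprime[OF N(3)] by blast
  obtain u v where uv: "u * k + v * h = 1"
    using hk(1) bezout_int[of k h] by (auto simp: coprime_iff_gcd_eq_1 gcd.commute)
  have det': "(-v) * (-h) - (-u) * k = 1"
    using uv by (simp add: algebra_simps)
  let ?j = "of_int k * z + of_int (- h)"
  have "\<bar>of_int k * Re z - of_int h\<bar> \<le> t"
  proof -
    have "1 / N \<le> t" using Nt N(3) by (simp add: field_simps)
    with hk(4) show ?thesis by linarith
  qed
  then have 1: "(of_int k * Re z - of_int h)\<^sup>2 \<le> t\<^sup>2"
    by (metis abs_ge_zero power2_abs power_mono)
  have "of_int k \<le> real N"
    using hk(3) by linarith
  then have "of_int k * y \<le> real N * t * t"
    using mult_right_mono[of "of_int k" "real N" y] t(2) y(1) by (simp add: mult.assoc)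
  also have "\<dots> \<le> 3 / 2 * t"
    using Nt t2 t by (intro mult_right_mono) auto
  finally have "(of_int k * y)\<^sup>2 \<le> (3 / 2 * t)\<^sup>2"
    using hk(2) y by (intro power_mono) auto
  then have "(norm ?j)\<^sup>2 \<le> t\<^sup>2 + (3 / 2 * t)\<^sup>2"
    unfolding cmod_power2 using 1 by (simp add: y_def)
  also have "\<dots> \<le> 4 * y"
    using t y by (simp add: power2_eq_square algebra_simps)
  finally have le: "(norm ?j)\<^sup>2 \<le> 4 * y" .
  have "?j \<noteq> 0"
    by (rule moebius_upper_half_plane(1)[OF det' assms])
  then have "1 / 4 \<le> Im z / (norm ?j)\<^sup>2"
    using le by (simp add: y_def pos_le_divide_eq)
  then show ?thesis
    unfolding moebius_upper_half_plane(2)[OF det' assms, symmetric] by (rule that[OF det'])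
qed

lemma modular_form_norm_invariant:
  fixes a b c d :: int
  assumes "modular_form k M" "a * d - b * c = 1" "z \<in> upper_half_plane"
  defines "w \<equiv> (of_int a * z + of_int b) / (of_int c * z + of_int d)"
  shows "Im w powr (real k / 2) * norm (M w) = Im z powr (real k / 2) * norm (M z)"
proof -
  let ?j = "of_int c * z + of_int d"
  have j: "norm ?j > 0" using moebius_upper_half_plane(1)[OF assms(2,3)] by simp
  have z: "Im z > 0" using assms by (simp add: upper_half_plane_def)
  have "M w = ?j ^ k * M z"
    using assms unfolding modular_form_def w_def by blast
  moreover have "Im w = Im z / (norm ?j)\<^sup>2"
    unfolding w_def by (rule moebius_upper_half_plane(2)[OF assms(2,3)])
  moreover have "((norm ?j)\<^sup>2) powr (real k / 2) = norm ?j ^ k"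
  proof -
    have "((norm ?j)\<^sup>2) powr (real k / 2) = (norm ?j powr 2) powr (real k / 2)"
      using j by (simp only: powr_numeral)
    then show ?thesis
      using powr_realpow[OF j, of k] by (simp only: powr_powr) simp
  qed
  ultimately show ?thesis
    using z j by (simp add: powr_divide norm_mult norm_power)
qed

text \<open>Convergence at \<open>\<i> / 8\<close> gives absolute convergence of the power series at
  the smaller radius \<open>norm \<rho>\<close>, which corresponds to height 1/4. As
  \<open>r 0 = 0\<close>, every nonzero term contains the factor
  \<open>exp (- 2 * pi * (Im z - 1 / 4))\<close>.\<close>

lemma fourier_expansion_bound_Im_ge_quarter:
  assumes F: "has_fourier_expansion M r" and r0: "r 0 = 0"
  obtains C where "C > 0" "\<And>z. Im z \<ge> 1 / 4 \<Longrightarrow> norm (M z) \<le> C * exp (- 2 * pi * Im z)"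
proof -
  define \<rho> :: complex where "\<rho> = exp (- of_real pi / 2)"
  have "(\<lambda>n. r n * exp (2 * of_real pi * \<i> * of_nat n * (\<i> / 8))) sums M (\<i> / 8)"
    using F[unfolded has_fourier_expansion_def, rule_format, of "\<i> / 8"]
    by (simp add: upper_half_plane_def)
  moreover have "exp (2 * of_real pi * \<i> * of_nat n * (\<i> / 8)) = exp (- of_real pi / 4 :: complex) ^ n" for n
    by (simp add: exp_of_nat_mult[symmetric] algebra_simps)
  ultimately have "summable (\<lambda>n. r n * exp (- of_real pi / 4) ^ n)"
    by (simp only: sums_iff)
  then have S: "summable (\<lambda>n. norm (r n * \<rho> ^ n))"
    by (rule powser_insidea) (simp add: \<rho>_def)
  have norm_\<rho>: "norm \<rho> = exp (- pi / 2)"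
    by (simp add: \<rho>_def)
  define C where "C = (\<Sum>n. norm (r n * \<rho> ^ n)) * exp (pi / 2)"
  have C0: "C \<ge> 0" unfolding C_def using S by (intro mult_nonneg_nonneg suminf_nonneg) auto
  show ?thesis
  proof (rule that[of "C + 1"])
    fix z :: complex assume z: "Im z \<ge> 1 / 4"
    let ?t = "\<lambda>n. r n * exp (2 * of_real pi * \<i> * of_nat n * z)"
    have sums: "?t sums M z"
      using F z by (auto simp: has_fourier_expansion_def upper_half_plane_def)
    have le: "norm (?t n) \<le> norm (r n * \<rho> ^ n) * exp (pi / 2 - 2 * pi * Im z)" for n
    proof (cases "n = 0")
      case True
      then show ?thesis using r0 by simp
    next
      case False
      have "(2 * pi * Im z - pi / 2) * 1 \<le> (2 * pi * Im z - pi / 2) * real n"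
        using False z by (intro mult_left_mono) auto
      then have "- 2 * pi * real n * Im z \<le> - pi / 2 * real n + (pi / 2 - 2 * pi * Im z)"
        by (simp add: algebra_simps)
      then have "exp (- 2 * pi * real n * Im z) \<le> exp (- pi / 2) ^ n * exp (pi / 2 - 2 * pi * Im z)"
        by (simp add: exp_of_nat_mult[symmetric] exp_add[symmetric] mult.commute)
      then have "norm (r n) * exp (- 2 * pi * real n * Im z) \<le> norm (r n) * (exp (- pi / 2) ^ n * exp (pi / 2 - 2 * pi * Im z))"
        by (intro mult_left_mono) auto
      then show ?thesis
        by (simp add: norm_mult norm_power norm_\<rho> algebra_simps)
    qed
    have "norm (M z) \<le> (\<Sum>n. norm (r n * \<rho> ^ n) * exp (pi / 2 - 2 * pi * Im z))"
      unfolding sums_unique[OF sums] by (intro norm_suminf_le summable_mult2 S le)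
    also have "\<dots> = C * exp (- 2 * pi * Im z)"
      unfolding suminf_mult2[OF S, symmetric] C_def mult.assoc exp_add[symmetric] by simp
    also have "\<dots> \<le> (C + 1) * exp (- 2 * pi * Im z)"
      by simp
    finally show "norm (M z) \<le> (C + 1) * exp (- 2 * pi * Im z)" .
  qed (use C0 in auto)
qed

text \<open>Above height 1/4 the Fourier expansion decays exponentially. A point below is moved to
  such a height by a modular map, which preserves \<open>Im z powr (k / 2) * norm (M z)\<close>. The
  factor \<open>exp (- Im z)\<close> is kept so that the later integrals over heights converge at
  infinity.\<close>

lemma cusp_form_growth:
  assumes "cusp_form k M r"
  obtains C where "C > 0"
    "\<forall>z\<in>upper_half_plane. norm (M z) \<le> C * Im z powr (- real k / 2) * exp (- Im z)"
proof -
  let ?\<kappa> = "real k / 2"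
  have mf: "modular_form k M" and F: "has_fourier_expansion M r" "r 0 = 0"
    using assms by (auto simp: cusp_form_def)
  obtain C1 where C1: "C1 > 0" "\<And>z. Im z \<ge> 1 / 4 \<Longrightarrow> norm (M z) \<le> C1 * exp (- 2 * pi * Im z)"
    using fourier_expansion_bound_Im_ge_quarter[OF F] by blast
  obtain C2 where C2: "C2 > 0" "\<And>y. y > 0 \<Longrightarrow> y powr ?\<kappa> * exp (- 1 * y) \<le> C2"
    using powr_mult_exp_bounded[of ?\<kappa> 1] by auto
  have pi2: "2 * pi \<ge> 2" using pi_ge_two by linarith
  have high: "Im z powr ?\<kappa> * norm (M z) \<le> C1 * C2 * exp (- Im z)" if "Im z \<ge> 1 / 4" for z
  proof -
    have "2 * Im z \<le> 2 * pi * Im z"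
      using that pi2 by (intro mult_right_mono) auto
    then have "norm (M z) \<le> C1 * exp (- 2 * Im z)"
      using C1(1) by (intro order.trans[OF C1(2)[OF that]] mult_left_mono) auto
    then have "Im z powr ?\<kappa> * norm (M z) \<le> Im z powr ?\<kappa> * (C1 * exp (- 2 * Im z))"
      by (intro mult_left_mono) auto
    also have "\<dots> = C1 * (Im z powr ?\<kappa> * exp (- 1 * Im z)) * exp (- Im z)"
      by (simp add: exp_add[symmetric])
    also have "\<dots> \<le> C1 * C2 * exp (- Im z)"
      using C1(1) C2(2)[of "Im z"] that by (intro mult_left_mono mult_right_mono) auto
    finally show ?thesis .
  qed
  have low: "Im z powr ?\<kappa> * norm (M z) \<le> C1 * C2" if z: "z \<in> upper_half_plane" for z
  proof -
    obtain w where w: "Im w \<ge> 1 / 4" "Im w powr ?\<kappa> * norm (M w) = Im z powr ?\<kappa> * norm (M z)"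
      using moebius_Im_ge_quarter[OF z] modular_form_norm_invariant[OF mf _ z] by metis
    have "Im z powr ?\<kappa> * norm (M z) \<le> C1 * C2 * exp (- Im w)"
      using high[OF w(1)] w(2) by simp
    also have "\<dots> \<le> C1 * C2 * 1"
      using w(1) C1 C2 by (intro mult_left_mono) auto
    finally show ?thesis by simp
  qed
  show ?thesis
  \<comment> \<open>The factor \<open>exp 1\<close> compensates \<open>exp (- Im z)\<close> at
    heights below 1/4, where the bound from invariance has no decay.\<close>
  proof (rule that[of "C1 * C2 * exp 1"]; (intro ballI)?)
    fix z assume z: "z \<in> upper_half_plane"
    then have y: "Im z > 0" by (simp add: upper_half_plane_def)
    have "Im z powr ?\<kappa> * norm (M z) \<le> C1 * C2 * exp 1 * exp (- Im z)"
    proof (cases "Im z \<ge> 1 / 4")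
      case True
      have "C1 * C2 * exp (- Im z) * 1 \<le> C1 * C2 * exp (- Im z) * exp 1"
        using C1 C2 by (intro mult_left_mono) auto
      with high[OF True] show ?thesis by (simp add: algebra_simps)
    next
      case False
      then have "C1 * C2 * 1 \<le> C1 * C2 * exp (1 - Im z)"
        using C1 C2 by (intro mult_left_mono) auto
      with low[OF z] have "Im z powr ?\<kappa> * norm (M z) \<le> C1 * C2 * exp (1 - Im z)"
        by linarith
      also have "exp (1 - Im z) = exp 1 * exp (- Im z)"
        by (simp add: exp_add[symmetric])
      finally show ?thesis by (simp only: mult.assoc)
    qed
    then show "norm (M z) \<le> C1 * C2 * exp 1 * Im z powr (- real k / 2) * exp (- Im z)"
    proof -
      assume *: "Im z powr ?\<kappa> * norm (M z) \<le> C1 * C2 * exp 1 * exp (- Im z)"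
      have "norm (M z) = Im z powr (- ?\<kappa>) * (Im z powr ?\<kappa> * norm (M z))"
        using y by (simp add: mult.assoc[symmetric] powr_add[symmetric])
      also have "\<dots> \<le> Im z powr (- ?\<kappa>) * (C1 * C2 * exp 1 * exp (- Im z))"
        by (intro mult_left_mono *) auto
      also have "\<dots> = C1 * C2 * exp 1 * Im z powr (- real k / 2) * exp (- Im z)"
        by (simp add: mult_ac)
      finally show ?thesis .
    qed
  qed (use C1 C2 in auto)
qed

text \<open>Hecke's argument: \<open>r n\<close> is a Taylor coefficient of the form as a function
  of \<open>exp (2 * pi * i * z)\<close>, and Cauchy's inequality is applied on the circle of height
  \<open>1 / n\<close>. There the form is at most \<open>C * n powr \<kappa>\<close>, while the
  radius satisfies \<open>R ^ n = exp (- 2 * pi)\<close>.\<close>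

lemma fourier_coefficient_bound:
  assumes F: "has_fourier_expansion M r" and r0: "r 0 = 0" and C: "C > 0"
    and growth: "\<forall>z\<in>upper_half_plane. norm (M z) \<le> C * Im z powr (- \<kappa>) * exp (- Im z)"
  obtains C' where "C' > 0" "\<And>n. norm (r (Suc n)) \<le> C' * real (Suc n) powr \<kappa>"
proof (rule that[of "C * exp (2 * pi)"])
  fix m :: nat
  define n where "n = Suc m"
  define G where "G w = (\<Sum>j. r j * w ^ j)" for w
  \<comment> \<open>The expansion is assumed for points of the half plane only; this lift transports
    its convergence to the whole punctured disc.\<close>
  have to_H: "\<exists>z\<in>upper_half_plane. w = exp (2 * of_real pi * \<i> * z) \<and> Im z = - ln (norm w) / (2 * pi)"
    if "norm w < 1" "w \<noteq> 0" for w
  proof (intro bexI conjI)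
    let ?z = "Ln w / (2 * of_real pi * \<i>)"
    show "w = exp (2 * of_real pi * \<i> * ?z)"
      using that by simp
    have "?z = - \<i> * Ln w / of_real (2 * pi)"
      by (simp add: field_simps)
    then have "Im ?z = Im (- \<i> * Ln w) / (2 * pi)"
      by (metis Im_divide_of_real)
    then show "Im ?z = - ln (norm w) / (2 * pi)"
      using that by simp
    moreover have "- ln (norm w) / (2 * pi) > 0"
      using that by (simp add: divide_neg_pos)
    ultimately show "?z \<in> upper_half_plane"
      unfolding upper_half_plane_def mem_Collect_eq by (simp only:)
  qed
  have GM: "(\<lambda>j. r j * exp (2 * of_real pi * \<i> * z) ^ j) sums M z" if "z \<in> upper_half_plane" for z
  proof -
    have "exp (2 * of_real pi * \<i> * of_nat j * z) = exp (2 * of_real pi * \<i> * z) ^ j" for j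
      by (simp add: exp_of_nat_mult[symmetric] mult_ac)
    moreover have "(\<lambda>j. r j * exp (2 * of_real pi * \<i> * of_nat j * z)) sums M z"
      using F that unfolding has_fourier_expansion_def by blast
    ultimately show ?thesis by (simp only:)
  qed
  have sums: "(\<lambda>j. r j * w ^ j) sums G w" if w: "norm w < 1" for w
  proof (cases "w = 0")
    case True
    then show ?thesis using powser_sums_zero[of r] by (simp add: G_def sums_iff)
  next
    case False
    then show ?thesis using to_H[OF w] GM by (auto simp: G_def sums_iff)
  qed
  have hol: "G holomorphic_on ball 0 1"
    by (rule power_series_holomorphic[where a = r]) (use sums in auto)
  have "\<forall>\<^sub>F w in nhds 0. w \<in> ball (0::complex) 1"
    by (intro eventually_nhds_in_open) auto
  then have "G has_fps_expansion Abs_fps r"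
    by (intro has_fps_expansionI) (auto elim!: eventually_mono intro!: sums)
  then have coeff: "r n = (deriv ^^ n) G 0 / fact n"
    using fps_nth_fps_expansion[of G "Abs_fps r" n] by simp
  define R where "R = exp (- 2 * pi / real n)"
  have n: "real n > 0" by (simp add: n_def)
  have R: "0 < R" "R < 1" using n by (auto simp: R_def divide_less_0_iff)
  define B where "B = C * real n powr \<kappa>"
  have "norm ((deriv ^^ n) G 0) \<le> fact n * B / R ^ n"
  proof (rule Cauchy_inequality)
    show "G holomorphic_on ball 0 R"
      using hol R by (auto elim: holomorphic_on_subset)
    show "continuous_on (cball 0 R) G"
      by (rule continuous_on_subset[OF holomorphic_on_imp_continuous_on[OF hol]]) (use R in auto)
    fix w :: complex assume "norm (0 - w) = R"
    then have w: "norm w = R" by simp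
    with R have "norm w < 1" "w \<noteq> 0" by auto
    from to_H[OF this] obtain z where z: "z \<in> upper_half_plane" "w = exp (2 * of_real pi * \<i> * z)"
      "Im z = 1 / real n"
      using w by (auto simp: R_def)
    have "G w = M z"
      using sums_unique2[OF sums[OF \<open>norm w < 1\<close>]] GM[OF z(1)] z(2) by simp
    moreover have "norm (M z) \<le> C * (1 / real n) powr (- \<kappa>) * 1"
    proof -
      have "C * Im z powr (- \<kappa>) * exp (- Im z) \<le> C * Im z powr (- \<kappa>) * 1"
        using C z(3) n by (intro mult_left_mono) auto
      then show ?thesis using bspec[OF growth z(1)] z(3) by simp
    qed
    ultimately show "norm (G w) \<le> B"
      using n by (simp add: B_def powr_divide powr_minus field_simps)
  qed (use R in auto)
  moreover have "R ^ n = exp (- 2 * pi)"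
    using n by (simp add: R_def exp_of_nat_mult[symmetric])
  ultimately have "norm (r n) \<le> B * exp (2 * pi)"
    unfolding coeff by (simp add: norm_divide field_simps exp_minus)
  then show "norm (r (Suc m)) \<le> C * exp (2 * pi) * real (Suc m) powr \<kappa>"
    by (simp add: B_def n_def mult_ac)
qed (use C in auto)

section \<open>The lower bound for the regularity\<close>

lemma open_upper_half_plane: "open upper_half_plane"
  unfolding upper_half_plane_def by (rule open_halfspace_Im_gt)

text \<open>Cauchy's inequality on the disc of radius \<open>Im z / 2\<close>, on which the height
  stays at least \<open>Im z / 2\<close>. This halves the rate of exponential decay.\<close>

lemma higher_deriv_bound_upper_half_plane:
  assumes hol: "M holomorphic_on upper_half_plane" and "C > 0" "\<kappa> \<ge> 0"
    and growth: "\<forall>z\<in>upper_half_plane. norm (M z) \<le> C * Im z powr (- \<kappa>) * exp (- Im z)"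
    and z: "z \<in> upper_half_plane"
  shows "norm ((deriv ^^ i) M z)
    \<le> fact i * (C * 2 powr \<kappa>) * (2 / Im z) ^ i * (Im z powr (- \<kappa>) * exp (- Im z / 2))"
proof -
  define y where "y = Im z"
  have y: "y > 0" using z by (simp add: y_def upper_half_plane_def)
  have near: "y / 2 \<le> Im w" if "norm (z - w) \<le> y / 2" for w
    using abs_Im_le_cmod[of "z - w"] that by (simp add: y_def)
  have sub: "cball z (y / 2) \<subseteq> upper_half_plane"
  proof
    fix w assume "w \<in> cball z (y / 2)"
    then have "y / 2 \<le> Im w" by (intro near) (simp add: dist_norm)
    with y show "w \<in> upper_half_plane" by (simp add: upper_half_plane_def)
  qed
  have "norm ((deriv ^^ i) M z) \<le> fact i * (C * (y / 2) powr (- \<kappa>) * exp (- (y / 2))) / (y / 2) ^ i"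
  proof (rule Cauchy_inequality)
    show "M holomorphic_on ball z (y / 2)"
      using hol sub ball_subset_cball by (blast intro: holomorphic_on_subset)
    show "continuous_on (cball z (y / 2)) M"
      using hol sub holomorphic_on_imp_continuous_on continuous_on_subset by blast
    fix w assume w: "norm (z - w) = y / 2"
    then have Imw: "y / 2 \<le> Im w" by (intro near) simp
    then have "Im w > 0" using y by linarith
    then have "w \<in> upper_half_plane" by (simp add: upper_half_plane_def)
    then have "norm (M w) \<le> C * Im w powr (- \<kappa>) * exp (- Im w)" by (rule bspec[OF growth])
    also have "\<dots> \<le> C * (y / 2) powr (- \<kappa>) * exp (- (y / 2))"
      using Imw y assms by (intro mult_mono mult_left_mono powr_mono2') auto
    finally show "norm (M w) \<le> C * (y / 2) powr (- \<kappa>) * exp (- (y / 2))" .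
  qed (use y in auto)
  also have "(y / 2) powr (- \<kappa>) = 2 powr \<kappa> * y powr (- \<kappa>)"
    using y by (simp add: powr_divide powr_minus_divide)
  finally show ?thesis
    by (simp add: y_def power_divide mult_ac)
qed

text \<open>The exponent \<open>\<beta>\<close> interpolates between the trivial bound for \<open>\<bar>h\<bar> \<ge> Im z\<close>
  and Taylor's theorem for \<open>\<bar>h\<bar> \<le> Im z\<close>.\<close>

lemma horizontal_taylor_upper_half_plane:
  assumes hol: "M holomorphic_on upper_half_plane" and C: "C > 0" "\<kappa> \<ge> 0"
    and growth: "\<forall>z\<in>upper_half_plane. norm (M z) \<le> C * Im z powr (- \<kappa>) * exp (- Im z)"
    and d: "real d \<le> \<beta>" "\<beta> \<le> real d + 1"
  obtains C' where "C' > 0"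
    "\<And>z h. z \<in> upper_half_plane \<Longrightarrow>
      norm (M (z + of_real h) - (\<Sum>i\<le>d. (deriv ^^ i) M z * of_real h ^ i / fact i))
        \<le> C' * (\<bar>h\<bar> / Im z) powr \<beta> * (Im z powr (- \<kappa>) * exp (- Im z / 2))"
proof -
  define A where "A = C * 2 powr \<kappa>"
  have A: "A > 0" using C by (simp add: A_def)
  note deriv_bound = higher_deriv_bound_upper_half_plane[OF hol C growth, folded A_def]
  \<comment> \<open>The summands pay for \<open>M (z + h)\<close> and for the Taylor terms when
    \<open>t \<ge> 1\<close>, and for the Taylor remainder when \<open>t < 1\<close>;
    \<open>real (Suc d)\<close> is the quotient of \<open>fact (Suc d)\<close> by
    \<open>fact d\<close>.\<close>
  define C' where "C' = A * (1 + (\<Sum>i\<le>d. 2 ^ i) + real (Suc d) * 2 ^ Suc d)"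
  have C'_ge: "C' \<ge> A * (1 + (\<Sum>i\<le>d. 2 ^ i))" "C' \<ge> A * (real (Suc d) * 2 ^ Suc d)" "C' > 0"
    using A by (auto simp: C'_def intro!: mult_left_mono mult_pos_pos add_pos_nonneg add_nonneg_nonneg sum_nonneg)
  show ?thesis
  proof (rule that[OF C'_ge(3)])
    fix z :: complex and h :: real
    assume z: "z \<in> upper_half_plane"
    define y where "y = Im z"
    have y: "y > 0" using z by (simp add: y_def upper_half_plane_def)
    define E where "E = y powr (- \<kappa>) * exp (- y / 2)"
    define t where "t = \<bar>h\<bar> / y"
    have E: "E > 0" using y by (simp add: E_def)
    have t: "t \<ge> 0" using y by (simp add: t_def)
    have db: "norm ((deriv ^^ i) M w) \<le> fact i * A * (2 / y) ^ i * E" if "Im w = y" for w i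
    proof -
      have "w \<in> upper_half_plane" using that y by (simp add: upper_half_plane_def)
      from deriv_bound[OF this] that show ?thesis by (simp add: E_def)
    qed
    have "norm (M (z + of_real h) - (\<Sum>i\<le>d. (deriv ^^ i) M z * of_real h ^ i / fact i)) \<le> C' * t powr \<beta> * E"
    proof (cases "t \<ge> 1")
      case True
      have term_le: "norm ((deriv ^^ i) M z * of_real h ^ i / fact i) \<le> A * 2 ^ i * t powr \<beta> * E" if "i \<le> d" for i
      proof -
        have "norm ((deriv ^^ i) M z * of_real h ^ i / fact i) = norm ((deriv ^^ i) M z) * (\<bar>h\<bar> ^ i / fact i)"
          by (simp add: norm_mult norm_divide norm_power)
        also have "\<dots> \<le> (fact i * A * (2 / y) ^ i * E) * (\<bar>h\<bar> ^ i / fact i)"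
          using db[of z i] by (intro mult_right_mono) (auto simp: y_def)
        also have "\<dots> = A * 2 ^ i * t ^ i * E"
          by (simp add: t_def power_divide)
        also have "t ^ i \<le> t powr \<beta>"
          using True that d by (simp add: powr_realpow[symmetric] powr_mono)
        then have "A * 2 ^ i * t ^ i * E \<le> A * 2 ^ i * t powr \<beta> * E"
          using A E by (intro mult_right_mono mult_left_mono) auto
        finally show ?thesis .
      qed
      have "norm (M (z + of_real h)) \<le> A * E"
        using db[of "z + of_real h" 0] by (simp add: y_def)
      also have "\<dots> \<le> A * t powr \<beta> * E"
      proof -
        have "A * E * 1 \<le> A * E * t powr \<beta>"
          using True d A E by (intro mult_left_mono ge_one_powr_ge_zero) auto
        then show ?thesis by (simp add: mult_ac)
      qed
      finally have 1: "norm (M (z + of_real h)) \<le> A * t powr \<beta> * E" .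
      have "norm (\<Sum>i\<le>d. (deriv ^^ i) M z * of_real h ^ i / fact i) \<le> (\<Sum>i\<le>d. A * 2 ^ i * t powr \<beta> * E)"
        by (intro sum_norm_le term_le) auto
      also have "\<dots> = A * (\<Sum>i\<le>d. 2 ^ i) * t powr \<beta> * E"
        by (simp add: sum_distrib_left sum_distrib_right)
      finally have 2: "norm (\<Sum>i\<le>d. (deriv ^^ i) M z * of_real h ^ i / fact i) \<le> A * (\<Sum>i\<le>d. 2 ^ i) * t powr \<beta> * E" .
      have "norm (M (z + of_real h) - (\<Sum>i\<le>d. (deriv ^^ i) M z * of_real h ^ i / fact i))
          \<le> A * t powr \<beta> * E + A * (\<Sum>i\<le>d. 2 ^ i) * t powr \<beta> * E"
        using 1 2 norm_triangle_ineq4 by (meson add_mono order_trans)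
      also have "\<dots> = (A * (1 + (\<Sum>i\<le>d. 2 ^ i))) * (t powr \<beta> * E)"
        by (simp add: algebra_simps)
      also have "\<dots> \<le> C' * (t powr \<beta> * E)"
        using E by (intro mult_right_mono C'_ge) auto
      finally show ?thesis by (simp add: mult.assoc)
    next
      case False
      \<comment> \<open>The derivative bounds depend on the height only, so they are uniform on this
        convex line.\<close>
      let ?S = "{w. Im w = y}"
      have conv: "convex ?S"
        by (auto simp: convex_def distrib_right[symmetric])
      have "norm ((deriv ^^ 0) M (z + of_real h) - (\<Sum>i\<le>d. (deriv ^^ i) M z * (z + of_real h - z) ^ i / fact i))
        \<le> (fact (Suc d) * A * (2 / y) ^ Suc d * E) * norm (z + of_real h - z) ^ Suc d / fact d"
      proof (rule complex_Taylor[OF conv])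
        fix i w assume w: "w \<in> ?S"
        then have "w \<in> upper_half_plane" using y by (simp add: upper_half_plane_def)
        then show "((deriv ^^ i) M has_field_derivative (deriv ^^ Suc i) M w) (at w within ?S)"
          by (intro DERIV_subset[OF has_field_derivative_higher_deriv[OF hol open_upper_half_plane]]) auto
        show "norm ((deriv ^^ Suc d) M w) \<le> fact (Suc d) * A * (2 / y) ^ Suc d * E"
          using w by (intro db) auto
      qed (auto simp: y_def)
      also have "\<dots> = A * (real (Suc d) * 2 ^ Suc d) * t ^ Suc d * E"
        using y by (simp add: t_def power_divide field_simps)
      also have "\<dots> \<le> C' * t ^ Suc d * E"
        using E t by (intro mult_right_mono C'_ge) auto
      also have "t ^ Suc d \<le> t powr \<beta>"
      proof (cases "t = 0")
        case False
        with t have t0: "t > 0" by simp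
        then have "t ^ Suc d = t powr real (Suc d)"
          using powr_realpow by metis
        also have "\<dots> \<le> t powr \<beta>"
          using \<open>\<not> t \<ge> 1\<close> t0 d by (intro powr_mono') auto
        finally show ?thesis .
      qed auto
      then have "C' * t ^ Suc d * E \<le> C' * t powr \<beta> * E"
        using E C'_ge by (intro mult_right_mono mult_left_mono) auto
      finally show ?thesis by simp
    qed
    then show "norm (M (z + of_real h) - (\<Sum>i\<le>d. (deriv ^^ i) M z * of_real h ^ i / fact i))
        \<le> C' * (\<bar>h\<bar> / Im z) powr \<beta> * (Im z powr (- \<kappa>) * exp (- Im z / 2))"
      by (simp add: t_def E_def y_def)
  qed
qed

section \<open>The Fourier series as an integral of the form over heights\<close>

definition fourier_series :: "(nat \<Rightarrow> complex) \<Rightarrow> real \<Rightarrow> real \<Rightarrow> complex" where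
  "fourier_series r s t =
     (\<Sum>n. r (Suc n) / of_real (real (Suc n) powr s) * exp (2 * of_real pi * \<i> * of_nat (Suc n) * of_real t))"

lemma norm_exp_2pi_i [simp]: "norm (exp (2 * complex_of_real pi * \<i> * of_nat n * of_real t)) = 1"
proof -
  have "2 * complex_of_real pi * \<i> * of_nat n * of_real t = \<i> * of_real (2 * pi * real n * t)"
    by simp
  then show ?thesis by (simp only: norm_exp_i_times)
qed

lemma vertical_line_in_upper_half_plane: "u > 0 \<Longrightarrow> of_real t + \<i> * of_real u \<in> upper_half_plane"
  by (simp add: upper_half_plane_def)

lemma fourier_series_mellin:
  assumes F: "has_fourier_expansion M r" "r 0 = 0" and s: "s > 0"
    and summable: "summable (\<lambda>n. norm (r (Suc n)) / real (Suc n) powr s)"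
  shows "has_bochner_integral (lebesgue_on {0<..})
    (\<lambda>u. of_real (u powr (s - 1)) * M (of_real t + \<i> * of_real u))
    (of_real (Gamma s / (2 * pi) powr s) * fourier_series r s t)"
proof -
  define a where "a n = r (Suc n) * exp (2 * of_real pi * \<i> * of_nat (Suc n) * of_real t)" for n
  have "(\<lambda>n. a n * of_real (exp (- 2 * pi * real (Suc n) * u))) sums M (of_real t + \<i> * of_real u)" if "u > 0" for u
  proof -
    let ?z = "of_real t + \<i> * of_real u"
    have "(\<lambda>n. r n * exp (2 * of_real pi * \<i> * of_nat n * ?z)) sums M ?z"
      using F(1) vertical_line_in_upper_half_plane[OF that, of t] unfolding has_fourier_expansion_def by blast
    then have "(\<lambda>n. r (Suc n) * exp (2 * of_real pi * \<i> * of_nat (Suc n) * ?z)) sums M ?z"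
      by (subst sums_Suc_iff) (simp add: F(2))
    moreover have "r (Suc n) * exp (2 * of_real pi * \<i> * of_nat (Suc n) * ?z) = a n * of_real (exp (- 2 * pi * real (Suc n) * u))" for n
    proof -
      have "2 * of_real pi * \<i> * of_nat (Suc n) * ?z = 2 * of_real pi * \<i> * of_nat (Suc n) * of_real t + of_real (- 2 * pi * real (Suc n) * u)"
        by (simp add: distrib_left mult_ac) (simp add: algebra_simps)
      then show ?thesis unfolding a_def by (simp only: exp_add exp_of_real mult.assoc)
    qed
    ultimately show ?thesis by (simp only:)
  qed
  moreover have "norm (a n) = norm (r (Suc n))" for n
    unfolding a_def norm_mult norm_exp_2pi_i by simp
  ultimately have "has_bochner_integral (lebesgue_on {0<..})
     (\<lambda>u. of_real (u powr (s - 1)) * M (of_real t + \<i> * of_real u))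
     (of_real (Gamma s / (2 * pi) powr s) * (\<Sum>n. a n / of_real (real (Suc n) powr s)))"
    using s summable by (intro has_bochner_integral_Gamma_series) auto
  also have "(\<Sum>n. a n / of_real (real (Suc n) powr s)) = fourier_series r s t"
    unfolding fourier_series_def a_def by (simp add: mult_ac)
  finally show ?thesis .
qed

text \<open>The polynomial has as coefficients the integrals over \<open>u\<close> of the Taylor
  coefficients of \<open>M\<close> on the vertical line above \<open>x\<close>; they converge near
  \<open>u = 0\<close> because \<open>i \<le> \<beta> < s - \<kappa>\<close>. The remainder
  contributes \<open>\<bar>h\<bar> powr \<beta>\<close> times a Gamma integral of order
  \<open>s - \<kappa> - \<beta>\<close>, which is where the strict inequality enters.\<close>

lemma fourier_series_hoelder:
  assumes F: "has_fourier_expansion M r" "r 0 = 0"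
    and summable: "summable (\<lambda>n. norm (r (Suc n)) / real (Suc n) powr s)"
    and hol: "M holomorphic_on upper_half_plane" and C: "C > 0" "\<kappa> \<ge> 0"
    and growth: "\<forall>z\<in>upper_half_plane. norm (M z) \<le> C * Im z powr (- \<kappa>) * exp (- Im z)"
    and \<beta>: "0 < \<beta>" "\<beta> < s - \<kappa>"
  obtains P B where "degree P \<le> nat \<lfloor>\<beta>\<rfloor>"
    "\<And>h. norm (fourier_series r s (x + h) - poly P (of_real h)) \<le> B * \<bar>h\<bar> powr \<beta>"
proof -
  define d where "d = nat \<lfloor>\<beta>\<rfloor>"
  have d: "real d \<le> \<beta>" "\<beta> \<le> real d + 1" using \<beta> by (simp_all add: d_def of_nat_nat)
  have s: "s > 0" using \<beta> C by linarith
  let ?L = "lebesgue_on {0::real<..}"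
  define c where "c = complex_of_real (Gamma s / (2 * pi) powr s)"
  have c: "c \<noteq> 0" using Gamma_real_pos[OF s] by (simp add: c_def)
  define f where "f i u = of_real (u powr (s - 1)) * ((deriv ^^ i) M (of_real x + \<i> * of_real u) / fact i)" for i u
  define A where "A = C * 2 powr \<kappa>"
  have A: "A > 0" using C by (simp add: A_def)
  have f_int: "integrable ?L (f i)" if "i \<le> d" for i
  proof (rule Bochner_Integration.integrable_bound[where
        f = "\<lambda>u. A * 2 ^ i * (u powr (s - \<kappa> - real i - 1) * exp (- (1 / 2) * u))"])
    have "s - \<kappa> - real i > 0" using that d \<beta> by linarith
    then have "integrable ?L (\<lambda>u. u powr (s - \<kappa> - real i - 1) * exp (- (1 / 2) * u))"
      using has_bochner_integral_Gamma[of "s - \<kappa> - real i" "1 / 2"] by (auto simp: has_bochner_integral_iff)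
    then show "integrable ?L (\<lambda>u. A * 2 ^ i * (u powr (s - \<kappa> - real i - 1) * exp (- (1 / 2) * u)))"
      by (intro integrable_mult_right)
    have "continuous_on upper_half_plane ((deriv ^^ i) M)"
      by (intro holomorphic_on_imp_continuous_on holomorphic_higher_deriv hol open_upper_half_plane)
    then have "continuous_on {0<..} (\<lambda>u. (deriv ^^ i) M (of_real x + \<i> * of_real u))"
      by (rule continuous_on_compose2) (auto intro!: continuous_intros vertical_line_in_upper_half_plane)
    then have "continuous_on {0<..} (f i)"
      unfolding f_def by (intro continuous_on_mult continuous_on_divide continuous_on_of_real
          continuous_on_powr continuous_on_const continuous_on_id) auto
    then show "f i \<in> borel_measurable ?L"
      by (intro continuous_imp_measurable_on_sets_lebesgue) auto
    show "AE u in ?L. norm (f i u) \<le> norm (A * 2 ^ i * (u powr (s - \<kappa> - real i - 1) * exp (- (1 / 2) * u)))"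
    proof (intro AE_I2)
      fix u assume "u \<in> space ?L"
      then have u: "u > 0" by simp
      have "norm (f i u) = u powr (s - 1) * (norm ((deriv ^^ i) M (of_real x + \<i> * of_real u)) / fact i)"
        by (simp add: f_def norm_mult norm_divide)
      also have "\<dots> \<le> u powr (s - 1) * ((fact i * A * (2 / u) ^ i * (u powr (- \<kappa>) * exp (- u / 2))) / fact i)"
        using higher_deriv_bound_upper_half_plane[OF hol C growth vertical_line_in_upper_half_plane[OF u, of x], of i]
        by (intro mult_left_mono divide_right_mono) (auto simp: A_def)
      also have "\<dots> = A * 2 ^ i * ((u powr (s - 1) * u powr (- \<kappa>) / u powr (real i)) * exp (- u / 2))"
        using u by (simp add: power_divide powr_realpow)
      also have "u powr (s - 1) * u powr (- \<kappa>) / u powr (real i) = u powr (s - \<kappa> - real i - 1)"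
        by (simp add: powr_add[symmetric] powr_diff[symmetric] algebra_simps)
      finally show "norm (f i u) \<le> norm (A * 2 ^ i * (u powr (s - \<kappa> - real i - 1) * exp (- (1 / 2) * u)))"
        using A by (simp add: abs_mult)
    qed
  qed
  define P where "P = (\<Sum>i\<le>d. monom (integral\<^sup>L ?L (f i) / c) i)"
  obtain C' where C': "C' > 0"
    "\<And>z h. z \<in> upper_half_plane \<Longrightarrow>
      norm (M (z + of_real h) - (\<Sum>i\<le>d. (deriv ^^ i) M z * of_real h ^ i / fact i))
        \<le> C' * (\<bar>h\<bar> / Im z) powr \<beta> * (Im z powr (- \<kappa>) * exp (- Im z / 2))"
    using horizontal_taylor_upper_half_plane[OF hol C growth d] by blast
  define J where "J = Gamma (s - \<kappa> - \<beta>) / (1 / 2) powr (s - \<kappa> - \<beta>)"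
  have J: "has_bochner_integral ?L (\<lambda>u. u powr (s - \<kappa> - \<beta> - 1) * exp (- (1 / 2) * u)) J"
    unfolding J_def using \<beta> by (intro has_bochner_integral_Gamma) auto
  show ?thesis
  proof (rule that[of P "C' * J / norm c"])
    show "degree P \<le> nat \<lfloor>\<beta>\<rfloor>"
      unfolding P_def d_def[symmetric]
      by (intro degree_sum_le) (auto intro: order.trans[OF degree_monom_le])
    fix h :: real
    define R where "R u = of_real (u powr (s - 1)) * M (of_real (x + h) + \<i> * of_real u) - (\<Sum>i\<le>d. f i u * of_real h ^ i)" for u
    have poly: "c * poly P (of_real h) = (\<Sum>i\<le>d. integral\<^sup>L ?L (f i) * of_real h ^ i)"
      using c by (simp add: P_def poly_sum poly_monom sum_distrib_left)
    have "has_bochner_integral ?L R (c * fourier_series r s (x + h) - (\<Sum>i\<le>d. integral\<^sup>L ?L (f i) * of_real h ^ i))"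
      unfolding R_def c_def using f_int
      by (intro has_bochner_integral_diff fourier_series_mellin F s summable has_bochner_integral_sum
          has_bochner_integral_mult_left has_bochner_integral_integrable) auto
    then have R: "integrable ?L R" "integral\<^sup>L ?L R = c * (fourier_series r s (x + h) - poly P (of_real h))"
      unfolding poly[symmetric] by (auto simp: has_bochner_integral_iff algebra_simps)
    have "norm (integral\<^sup>L ?L R) \<le> (\<integral>u. C' * \<bar>h\<bar> powr \<beta> * (u powr (s - \<kappa> - \<beta> - 1) * exp (- (1 / 2) * u)) \<partial>?L)"
    proof (rule order.trans[OF integral_norm_bound integral_mono])
      show "integrable ?L (\<lambda>u. norm (R u))" using R by auto
      show "integrable ?L (\<lambda>u. C' * \<bar>h\<bar> powr \<beta> * (u powr (s - \<kappa> - \<beta> - 1) * exp (- (1 / 2) * u)))"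
        using J by (intro integrable_mult_right) (auto simp: has_bochner_integral_iff)
      fix u assume "u \<in> space ?L"
      then have u: "u > 0" by simp
      let ?z = "of_real x + \<i> * of_real u"
      have "R u = of_real (u powr (s - 1)) * (M (?z + of_real h) - (\<Sum>i\<le>d. (deriv ^^ i) M ?z * of_real h ^ i / fact i))"
        unfolding R_def f_def by (simp add: sum_distrib_left right_diff_distrib mult_ac add_ac)
      then have "norm (R u) = u powr (s - 1) * norm (M (?z + of_real h) - (\<Sum>i\<le>d. (deriv ^^ i) M ?z * of_real h ^ i / fact i))"
        by (simp add: norm_mult)
      also have "\<dots> \<le> u powr (s - 1) * (C' * (\<bar>h\<bar> / u) powr \<beta> * (u powr (- \<kappa>) * exp (- u / 2)))"
        using C'(2)[OF vertical_line_in_upper_half_plane[OF u, of x], of h] by (intro mult_left_mono) auto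
      also have "\<dots> = C' * \<bar>h\<bar> powr \<beta> * ((u powr (s - 1) * u powr (- \<kappa>) / u powr \<beta>) * exp (- u / 2))"
        using u by (simp add: powr_divide)
      also have "u powr (s - 1) * u powr (- \<kappa>) / u powr \<beta> = u powr (s - \<kappa> - \<beta> - 1)"
        by (simp add: powr_add[symmetric] powr_diff[symmetric] algebra_simps)
      finally show "norm (R u) \<le> C' * \<bar>h\<bar> powr \<beta> * (u powr (s - \<kappa> - \<beta> - 1) * exp (- (1 / 2) * u))"
        by simp
    qed
    also have "\<dots> = C' * \<bar>h\<bar> powr \<beta> * J"
      using has_bochner_integral_integral_eq[OF J] by simp
    finally have "norm c * norm (fourier_series r s (x + h) - poly P (of_real h)) \<le> C' * \<bar>h\<bar> powr \<beta> * J"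
      unfolding R(2) norm_mult .
    then show "norm (fourier_series r s (x + h) - poly P (of_real h)) \<le> C' * J / norm c * \<bar>h\<bar> powr \<beta>"
      using c by (simp add: field_simps)
  qed
qed

lemma fourier_series_sums:
  assumes "summable (\<lambda>n. norm (r (Suc n)) / real (Suc n) powr s)"
  shows "(\<lambda>n. r (Suc n) / of_real (real (Suc n) powr s) *
    exp (2 * of_real pi * \<i> * of_nat (Suc n) * of_real t)) sums fourier_series r s t"
  unfolding fourier_series_def
proof (intro summable_sums, rule summable_norm_cancel)
  show "summable (\<lambda>n. norm (r (Suc n) / of_real (real (Suc n) powr s) *
      exp (2 * of_real pi * \<i> * of_nat (Suc n) * of_real t)))"
    unfolding norm_mult norm_exp_2pi_i using assms by (simp add: norm_divide)
qed

lemma sine_series_eq: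
  assumes "summable (\<lambda>n. norm (r (Suc n)) / real (Suc n) powr s)"
  shows "sine_series r s t = (fourier_series r s t - fourier_series r s (- t)) / (2 * \<i>)"
proof -
  have "(r (Suc n) / of_real (real (Suc n) powr s) * exp (2 * of_real pi * \<i> * of_nat (Suc n) * of_real t)
      - r (Suc n) / of_real (real (Suc n) powr s) * exp (2 * of_real pi * \<i> * of_nat (Suc n) * of_real (- t))) / (2 * \<i>)
      = r (Suc n) / of_real (real (Suc n) powr s) * of_real (sin (2 * pi * real (Suc n) * t))" for n
  proof -
    define \<theta> where "\<theta> = 2 * pi * real (Suc n) * t"
    have e: "2 * of_real pi * \<i> * of_nat (Suc n) * of_real t = \<i> * of_real \<theta>"
      "2 * of_real pi * \<i> * of_nat (Suc n) * of_real (- t) = - (\<i> * of_real \<theta>)"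
      by (simp_all add: \<theta>_def)
    have "complex_of_real (sin \<theta>) = (exp (\<i> * of_real \<theta>) - exp (- (\<i> * of_real \<theta>))) / (2 * \<i>)"
      unfolding sin_of_real[symmetric] by (rule sin_exp_eq)
    then show ?thesis unfolding e \<theta>_def[symmetric] by (simp only: right_diff_distrib times_divide_eq_right)
  qed
  then have "(\<lambda>n. r (Suc n) / of_real (real (Suc n) powr s) * of_real (sin (2 * pi * real (Suc n) * t))) sums
      ((fourier_series r s t - fourier_series r s (- t)) / (2 * \<i>))"
    using sums_divide[OF sums_diff[OF fourier_series_sums[OF assms, of t] fourier_series_sums[OF assms, of "- t"]], of "2 * \<i>"]
    by (simp only:)
  then show ?thesis unfolding sine_series_def by (rule sums_unique[symmetric])
qed

lemma sine_series_hoelder_at: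
  assumes F: "has_fourier_expansion M r" "r 0 = 0"
    and summable: "summable (\<lambda>n. norm (r (Suc n)) / real (Suc n) powr s)"
    and hol: "M holomorphic_on upper_half_plane" and C: "C > 0" "\<kappa> \<ge> 0"
    and growth: "\<forall>z\<in>upper_half_plane. norm (M z) \<le> C * Im z powr (- \<kappa>) * exp (- Im z)"
    and \<beta>: "0 < \<beta>" "\<beta> < s - \<kappa>"
  shows "hoelder_at \<beta> (sine_series r s) x"
proof -
  obtain P B where P: "degree P \<le> nat \<lfloor>\<beta>\<rfloor>"
    "\<And>h. norm (fourier_series r s (x + h) - poly P (of_real h)) \<le> B * \<bar>h\<bar> powr \<beta>"
    using fourier_series_hoelder[OF assms, of x] by blast
  obtain P' B' where P': "degree P' \<le> nat \<lfloor>\<beta>\<rfloor>"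
    "\<And>h. norm (fourier_series r s (- x + h) - poly P' (of_real h)) \<le> B' * \<bar>h\<bar> powr \<beta>"
    using fourier_series_hoelder[OF assms, of "- x"] by blast
  \<comment> \<open>Near \<open>x\<close>, \<open>fourier_series r s (- t)\<close> is the series
    near \<open>- x\<close> with increment \<open>- (t - x)\<close>, hence the reflection of
    \<open>P'\<close>.\<close>
  define Q where "Q = smult (1 / (2 * \<i>)) (P - pcompose P' [:0, -1:])"
  have "degree (P - pcompose P' [:0, -1:]) \<le> nat \<lfloor>\<beta>\<rfloor>"
    using P(1) P'(1) by (intro degree_diff_le) (auto simp: degree_pcompose)
  then have deg: "degree Q \<le> nat \<lfloor>\<beta>\<rfloor>"
    unfolding Q_def by (rule order.trans[OF degree_smult_le])
  have "norm (sine_series r s t - poly Q (of_real (t - x))) \<le> (B + B') / 2 * \<bar>t - x\<bar> powr \<beta>" for t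
  proof -
    define h where "h = t - x"
    have t: "t = x + h" "- t = - x + (- h)" by (simp_all add: h_def)
    have "sine_series r s t - poly Q (of_real h) =
      ((fourier_series r s (x + h) - poly P (of_real h))
        - (fourier_series r s (- x + (- h)) - poly P' (of_real (- h)))) / (2 * \<i>)"
      unfolding sine_series_eq[OF summable] t(2) unfolding t(1) Q_def
      by (simp add: poly_pcompose field_simps)
    also have "norm \<dots> = norm ((fourier_series r s (x + h) - poly P (of_real h))
        - (fourier_series r s (- x + (- h)) - poly P' (of_real (- h)))) / 2"
      by (simp only: norm_divide norm_mult norm_ii norm_numeral mult_1_right)
    also have "\<dots> \<le> (B * \<bar>h\<bar> powr \<beta> + B' * \<bar>- h\<bar> powr \<beta>) / 2"
      by (intro divide_right_mono order.trans[OF norm_triangle_ineq4 add_mono[OF P(2)[of h] P'(2)[of "- h"]]]) auto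
    finally show ?thesis by (simp add: h_def algebra_simps add_divide_distrib abs_minus_commute)
  qed
  then show ?thesis
    unfolding hoelder_at_def using deg by (intro exI[of _ Q] exI[of _ "(B + B') / 2"]) auto
qed

section \<open>The fractional kernel\<close>

lemma summable_powr_exp:
  fixes p c :: real
  assumes "p \<ge> 0" "c > 0"
  shows "summable (\<lambda>n. real n powr p * exp (- c * real n))"
proof -
  obtain C where C: "C > 0" "\<And>y. y > 0 \<Longrightarrow> y powr p * exp (- (c / 2) * y) \<le> C"
    using powr_mult_exp_bounded[of p "c / 2"] assms by auto
  have "norm (exp (- (c / 2))) < 1" using assms by simp
  then have "summable (\<lambda>n. C * exp (- (c / 2)) ^ n)"
    by (intro summable_mult summable_geometric)
  then show ?thesis
  proof (rule summable_comparison_test'[where N = 0])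
    fix n :: nat
    have "real n powr p * exp (- (c / 2) * real n) \<le> C"
      using C(1) C(2)[of "real n"] by (cases "n = 0") auto
    then have "real n powr p * exp (- (c / 2) * real n) * exp (- (c / 2) * real n) \<le> C * exp (- (c / 2) * real n)"
      by (intro mult_right_mono) auto
    then show "norm (real n powr p * exp (- c * real n)) \<le> C * exp (- (c / 2)) ^ n"
      by (simp add: exp_of_nat_mult[symmetric] mult.assoc exp_add[symmetric] mult_ac)
  qed
qed

lemma summable_power_powser:
  fixes q :: complex
  assumes "norm q < 1"
  shows "summable (\<lambda>n. norm (of_nat n ^ L * q ^ n))"
proof (cases "q = 0")
  case True
  have "summable (\<lambda>n. norm ((of_nat n ^ L :: complex) * 0 ^ n))"
    by (rule summable_finite[of "{0}"]) auto
  then show ?thesis using True by simp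
next
  case False
  then have c: "- ln (norm q) > 0" using assms by simp
  have "summable (\<lambda>n. real n powr real L * exp (- (- ln (norm q)) * real n))"
    by (rule summable_powr_exp) (use c in auto)
  then show ?thesis
  proof (rule summable_comparison_test'[where N = 1])
    fix n :: nat assume "1 \<le> n"
    have "exp (- (- ln (norm q)) * real n) = norm q ^ n"
      using False by (simp add: exp_of_nat2_mult)
    then show "norm (norm (of_nat n ^ L * q ^ n)) \<le> real n powr real L * exp (- (- ln (norm q)) * real n)"
      using \<open>1 \<le> n\<close> by (simp add: norm_mult norm_power powr_realpow)
  qed
qed

text \<open>For \<open>L > 0\<close> this is the polylogarithm of order \<open>- L\<close>, a
  rational function whose only pole is at 1, of order \<open>L + 1\<close>. For \<open>L = 0\<close>
  the term at \<open>n = 0\<close> is 1, which makes it the geometric series.\<close>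

definition power_powser :: "nat \<Rightarrow> complex \<Rightarrow> complex" where
  "power_powser L q = (\<Sum>n. of_nat n ^ L * q ^ n)"

lemma power_powser_sums: "norm q < 1 \<Longrightarrow> (\<lambda>n. of_nat n ^ L * q ^ n) sums power_powser L q"
  unfolding power_powser_def by (rule summable_sums, rule summable_norm_cancel, rule summable_power_powser)

text \<open>Multiplying by \<open>1 - q\<close> produces the differences
  \<open>(n + 1) ^ L - n ^ L\<close>, in whose binomial expansion the top power cancels. The pole
  order thus grows by one with each step in \<open>L\<close>.\<close>

lemma power_powser_rec:
  assumes q: "norm q < 1" and L: "L > 0"
  shows "(1 - q) * power_powser L q = q * (\<Sum>j<L. of_nat (L choose j) * power_powser j q)"
proof -
  have 1: "(\<lambda>n. of_nat (Suc n) ^ L * q ^ Suc n) sums power_powser L q"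
    using power_powser_sums[OF q, of L] L by (subst sums_Suc_iff) (simp add: zero_power)
  have 2: "(\<lambda>n. q * (of_nat n ^ L * q ^ n)) sums (q * power_powser L q)"
    by (intro sums_mult power_powser_sums q)
  have 3: "(\<lambda>n. q * (\<Sum>j<L. of_nat (L choose j) * (of_nat n ^ j * q ^ n))) sums
      (q * (\<Sum>j<L. of_nat (L choose j) * power_powser j q))"
    by (intro sums_mult sums_sum power_powser_sums q)
  have "of_nat (Suc n) ^ L * q ^ Suc n - q * (of_nat n ^ L * q ^ n)
      = q * (\<Sum>j<L. of_nat (L choose j) * (of_nat n ^ j * q ^ n))" for n
  proof -
    have "(of_nat (Suc n) :: complex) ^ L = (of_nat n + 1) ^ L"
      by (simp add: add.commute)
    also have "\<dots> = (\<Sum>j\<le>L. of_nat (L choose j) * of_nat n ^ j)"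
      by (simp add: binomial_ring)
    also have "\<dots> = (\<Sum>j<L. of_nat (L choose j) * of_nat n ^ j) + of_nat n ^ L"
      by (simp add: lessThan_Suc_atMost[symmetric])
    finally show ?thesis
      by (simp add: algebra_simps sum_distrib_left sum_distrib_right)
  qed
  then have "(\<lambda>n. q * (\<Sum>j<L. of_nat (L choose j) * (of_nat n ^ j * q ^ n))) sums (power_powser L q - q * power_powser L q)"
    using sums_diff[OF 1 2] by (simp only:)
  then show ?thesis
    using sums_unique2[OF 3] by (simp add: algebra_simps)
qed

text \<open>Induction along the recursion. The factor \<open>norm q\<close> for \<open>L > 0\<close>
  records the vanishing at \<open>q = 0\<close>, which later gives decay at large heights.\<close>

lemma power_powser_bound:
  "\<exists>C>0. \<forall>q. norm q < 1 \<longrightarrow>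
     norm (power_powser L q) \<le> C * (if L = 0 then 1 else norm q) / norm (1 - q) ^ Suc L"
proof (induction L rule: less_induct)
  case (less L)
  show ?case
  proof (cases "L = 0")
    case True
    have "power_powser 0 q = 1 / (1 - q)" if "norm q < 1" for q
      using geometric_sums[OF that] by (simp add: power_powser_def sums_iff)
    then show ?thesis using True by (intro exI[of _ 1]) (simp add: norm_divide)
  next
    case False
    have "\<exists>C. \<forall>j<L. C j > 0 \<and> (\<forall>q. norm q < 1 \<longrightarrow> norm (power_powser j q) \<le> C j * (if j = 0 then 1 else norm q) / norm (1 - q) ^ Suc j)"
      using less.IH by (intro choice) blast
    then obtain C where C: "\<And>j. j < L \<Longrightarrow> C j > 0"
      "\<And>j q. j < L \<Longrightarrow> norm q < 1 \<Longrightarrow> norm (power_powser j q) \<le> C j * (if j = 0 then 1 else norm q) / norm (1 - q) ^ Suc j"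
      by blast
    \<comment> \<open>The powers of 2 raise all pole orders \<open>Suc j\<close> to the common order
      \<open>L\<close>, as \<open>norm (1 - q) \<le> 2\<close>.\<close>
    define D where "D = 1 + (\<Sum>j<L. of_nat (L choose j) * (C j * 2 ^ (L - Suc j)))"
    have D: "D > 0"
      unfolding D_def using C(1) by (intro add_pos_nonneg sum_nonneg) (auto simp: less_imp_le)
    have "norm (power_powser L q) \<le> D * norm q / norm (1 - q) ^ Suc L" if q: "norm q < 1" for q
    proof -
      define m where "m = norm (1 - q)"
      have m0: "m > 0" using q by (auto simp: m_def)
      have m2: "m \<le> 2" using norm_triangle_ineq4[of 1 q] q by (simp add: m_def)
      have jb: "norm (of_nat (L choose j) * power_powser j q) \<le> of_nat (L choose j) * (C j * 2 ^ (L - Suc j)) / m ^ L"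
        if j: "j < L" for j
      proof -
        have "norm (power_powser j q) \<le> C j * (if j = 0 then 1 else norm q) / m ^ Suc j"
          unfolding m_def by (rule C(2)[OF j q])
        also have "\<dots> \<le> C j * 1 / m ^ Suc j"
          using q m0 C(1)[OF j] by (intro divide_right_mono mult_left_mono) auto
        also have "\<dots> = C j * m ^ (L - Suc j) / m ^ L"
        proof -
          have "m ^ L = m ^ (L - Suc j) * m ^ Suc j"
            unfolding power_add[symmetric] using j by simp
          then show ?thesis using m0 by simp
        qed
        also have "\<dots> \<le> C j * 2 ^ (L - Suc j) / m ^ L"
          using m0 m2 C(1)[OF j] by (intro divide_right_mono mult_left_mono power_mono) auto
        finally have "of_nat (L choose j) * norm (power_powser j q) \<le> of_nat (L choose j) * (C j * 2 ^ (L - Suc j) / m ^ L)"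
          by (intro mult_left_mono) auto
        then show ?thesis by (simp add: norm_mult)
      qed
      have "m * norm (power_powser L q) = norm q * norm (\<Sum>j<L. of_nat (L choose j) * power_powser j q)"
        using arg_cong[OF power_powser_rec[OF q, of L], of norm] False by (simp add: norm_mult m_def)
      also have "norm (\<Sum>j<L. of_nat (L choose j) * power_powser j q)
         \<le> (\<Sum>j<L. of_nat (L choose j) * (C j * 2 ^ (L - Suc j)) / m ^ L)"
        by (intro sum_norm_le jb) auto
      also have "\<dots> \<le> D / m ^ L"
        using m0 unfolding sum_divide_distrib[symmetric] by (intro divide_right_mono) (auto simp: D_def)
      finally have "m * norm (power_powser L q) \<le> norm q * (D / m ^ L)"
        by (simp add: mult_left_mono)
      then show ?thesis
        using m0 by (simp add: m_def[symmetric] field_simps)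
    qed
    then show ?thesis using D False by (intro exI[of _ D]) auto
  qed
qed

lemma sin_ge_linear:
  fixes x :: real
  assumes "0 \<le> x" "x \<le> pi / 2"
  shows "x / 3 \<le> sin x"
proof -
  have "x \<le> 2" using assms pi_less_4 by linarith
  then have "x * x \<le> 2 * 2" using assms by (intro mult_mono) auto
  then have "x * (x * x) \<le> x * 4" using assms by (intro mult_left_mono) auto
  moreover have "\<bar>sin x - x\<bar> \<le> x * (x * x) / 6"
    using Maclaurin_sin_bound[of x 3] assms
    by (simp add: eval_nat_numeral sin_coeff_def fact_numeral)
  ultimately show ?thesis by linarith
qed

text \<open>With \<open>\<rho>\<close> the modulus of the exponential, the squared distance to 1 is
  \<open>(1 - \<rho>)\<^sup>2 + 4 * \<rho> * (sin (pi * u))\<^sup>2\<close>. The first summand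
  dominates \<open>(\<rho> * v)\<^sup>2\<close> and the second
  \<open>(\<rho> * u)\<^sup>2\<close>.\<close>

lemma norm_one_minus_exp_ge:
  assumes "\<bar>Re w\<bar> \<le> 1 / 2" "Im w > 0"
  shows "norm (1 - exp (2 * of_real pi * \<i> * w)) \<ge> exp (- 2 * pi * Im w) * norm w"
proof -
  define u v where "u = Re w" and "v = Im w"
  define \<rho> where "\<rho> = exp (- 2 * pi * v)"
  have v: "v > 0" using assms by (simp add: v_def)
  have \<rho>: "0 < \<rho>" "\<rho> \<le> 1" using v by (auto simp: \<rho>_def)
  have e: "exp (2 * of_real pi * \<i> * w) = of_real \<rho> * cis (2 * pi * u)"
    by (simp add: exp_eq_polar \<rho>_def u_def v_def)
  have cos: "cos (2 * pi * u) = 1 - 2 * (sin (pi * u))\<^sup>2"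
    using cos_double_sin[of "pi * u"] by (simp add: mult.assoc)
  have expand: "(1 - \<rho> * K)\<^sup>2 + (\<rho> * S)\<^sup>2 = 1 - 2 * \<rho> * K + \<rho>\<^sup>2 * (S\<^sup>2 + K\<^sup>2)" for K S :: real
    by (simp add: power2_eq_square algebra_simps)
  have "(norm (1 - exp (2 * of_real pi * \<i> * w)))\<^sup>2 = (1 - \<rho> * cos (2 * pi * u))\<^sup>2 + (\<rho> * sin (2 * pi * u))\<^sup>2"
    unfolding e cmod_power2 by simp
  also have "\<dots> = 1 - 2 * \<rho> * cos (2 * pi * u) + \<rho>\<^sup>2 * ((sin (2 * pi * u))\<^sup>2 + (cos (2 * pi * u))\<^sup>2)"
    by (rule expand)
  also have "\<dots> = (1 - \<rho>)\<^sup>2 + 4 * \<rho> * (sin (pi * u))\<^sup>2"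
    unfolding sin_cos_squared_add unfolding cos by (simp add: power2_eq_square algebra_simps)
  finally have eq: "(norm (1 - exp (2 * of_real pi * \<i> * w)))\<^sup>2 = (1 - \<rho>)\<^sup>2 + 4 * \<rho> * (sin (pi * u))\<^sup>2" .
  have "\<bar>u\<bar> \<le> \<bar>2 * sin (pi * u)\<bar>"
  proof -
    have "pi * \<bar>u\<bar> / 3 \<le> sin (pi * \<bar>u\<bar>)"
      using assms by (intro sin_ge_linear) (auto simp: u_def)
    moreover have "2 * \<bar>u\<bar> \<le> pi * \<bar>u\<bar>"
      using mult_right_mono[OF pi_ge_two, of "\<bar>u\<bar>"] by simp
    moreover have "sin (pi * \<bar>u\<bar>) \<le> \<bar>sin (pi * u)\<bar>"
      by (cases "u \<ge> 0") auto
    ultimately show ?thesis by linarith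
  qed
  then have "u\<^sup>2 \<le> (2 * sin (pi * u))\<^sup>2" by (simp only: abs_le_square_iff)
  then have u2: "u\<^sup>2 \<le> 4 * (sin (pi * u))\<^sup>2" by (simp add: power_mult_distrib)
  have "\<rho> * (1 + 2 * pi * v) \<le> \<rho> * exp (2 * pi * v)"
    using \<rho> by (intro mult_left_mono) (auto simp: exp_ge_add_one_self)
  also have "\<dots> = 1" by (simp add: \<rho>_def exp_add[symmetric])
  finally have "\<rho> * (2 * pi * v) \<le> 1 - \<rho>" by (simp add: algebra_simps)
  moreover have "\<rho> * v \<le> \<rho> * (2 * pi * v)"
    using \<rho> v pi_ge_two by (intro mult_left_mono) (auto simp: mult_le_cancel_right1)
  ultimately have "\<rho> * v \<le> 1 - \<rho>" by linarith
  then have "(\<rho> * v)\<^sup>2 \<le> (1 - \<rho>)\<^sup>2"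
    using \<rho> v by (intro power_mono) auto
  moreover have "(\<rho> * u)\<^sup>2 \<le> 4 * \<rho> * (sin (pi * u))\<^sup>2"
  proof -
    have "\<rho>\<^sup>2 \<le> \<rho>" using \<rho> by (simp add: power2_eq_square mult_left_le)
    then have "\<rho>\<^sup>2 * u\<^sup>2 \<le> \<rho> * (4 * (sin (pi * u))\<^sup>2)" using u2 \<rho> by (intro mult_mono) auto
    then show ?thesis by (simp add: power_mult_distrib mult_ac)
  qed
  moreover have "(\<rho> * norm w)\<^sup>2 = (\<rho> * u)\<^sup>2 + (\<rho> * v)\<^sup>2"
    by (simp add: power_mult_distrib cmod_power2 u_def v_def algebra_simps)
  ultimately have "(\<rho> * norm w)\<^sup>2 \<le> (norm (1 - exp (2 * of_real pi * \<i> * w)))\<^sup>2"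
    unfolding eq by linarith
  then have "\<rho> * norm w \<le> norm (1 - exp (2 * of_real pi * \<i> * w))"
    by (rule power2_le_imp_le) (rule norm_ge_zero)
  then show ?thesis
    unfolding \<rho>_def v_def .
qed

lemma norm_exp_2pi_i_eq: "norm (exp (2 * complex_of_real pi * \<i> * w)) = exp (- 2 * pi * Im w)"
  by simp

text \<open>For \<open>Im w \<le> 1\<close> the distance of \<open>q\<close> to 1 is at least
  \<open>exp (- 2 * pi) * norm w\<close>. For \<open>Im w > 1\<close> it is at least 1/2,
  \<open>norm w\<close> is at most \<open>2 * Im w\<close>, and the factor \<open>norm q\<close>
  absorbs the power of \<open>Im w\<close>. The constant \<open>C\<close> is the larger of the two
  resulting ones.\<close>

lemma power_powser_strip_bound:
  assumes "L > 0"
  obtains C where "C > 0" "\<And>w. \<bar>Re w\<bar> \<le> 1 / 2 \<Longrightarrow> Im w > 0 \<Longrightarrow>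
    norm (power_powser L (exp (2 * of_real pi * \<i> * w))) \<le> C / norm w ^ Suc L"
proof -
  obtain D where D: "D > 0" "\<And>q. norm q < 1 \<Longrightarrow> norm (power_powser L q) \<le> D * norm q / norm (1 - q) ^ Suc L"
    using power_powser_bound[of L] assms by auto
  obtain E where E: "E > 0" "\<And>y. y > 0 \<Longrightarrow> y powr real (Suc L) * exp (- (2 * pi) * y) \<le> E"
    using powr_mult_exp_bounded[of "real (Suc L)" "2 * pi"] by auto
  define C where "C = max (D * exp (2 * pi) ^ Suc L) (D * 4 ^ Suc L * E)"
  show ?thesis
  proof (rule that[of C])
    show "C > 0" using D(1) by (simp add: C_def less_max_iff_disj)
    fix w assume w: "\<bar>Re w\<bar> \<le> 1 / 2" "Im w > 0"
    define v where "v = Im w"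
    have v: "v > 0" using w by (simp add: v_def)
    define q where "q = exp (2 * of_real pi * \<i> * w)"
    have nq: "norm q = exp (- 2 * pi * v)" unfolding q_def v_def by (rule norm_exp_2pi_i_eq)
    then have q1: "norm q < 1" using v by simp
    then have m: "norm (1 - q) > 0" by auto
    have w0: "norm w > 0" using w by auto
    have "norm q * norm w ^ Suc L * D \<le> C * norm (1 - q) ^ Suc L"
    proof (cases "v \<le> 1")
      case True
      have "exp (- (2 * pi)) * norm w \<le> exp (- 2 * pi * v) * norm w"
        using True by (intro mult_right_mono) auto
      also have "\<dots> \<le> norm (1 - q)"
        unfolding q_def v_def by (rule norm_one_minus_exp_ge[OF w])
      finally have "norm w \<le> exp (2 * pi) * norm (1 - q)"
        by (simp add: exp_minus field_simps)
      then have "norm w ^ Suc L \<le> (exp (2 * pi) * norm (1 - q)) ^ Suc L"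
        by (intro power_mono) auto
      then have "norm q * norm w ^ Suc L \<le> 1 * (exp (2 * pi) * norm (1 - q)) ^ Suc L"
        using q1 by (intro mult_mono) auto
      then have "norm q * norm w ^ Suc L * D \<le> (exp (2 * pi) * norm (1 - q)) ^ Suc L * D"
        using D(1) by (intro mult_right_mono) auto
      also have "\<dots> = (D * exp (2 * pi) ^ Suc L) * norm (1 - q) ^ Suc L"
        by (simp only: power_mult_distrib mult_ac)
      also have "\<dots> \<le> C * norm (1 - q) ^ Suc L"
        by (intro mult_right_mono) (auto simp: C_def)
      finally show ?thesis .
    next
      case False
      have "norm w \<le> \<bar>Re w\<bar> + \<bar>Im w\<bar>" by (rule cmod_le)
      then have w2: "norm w \<le> 2 * v" using w False by (simp add: v_def)
      have "norm q \<le> exp (- 1)"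
        unfolding nq using False pi_ge_two mult_mono[of 1 "2 * pi" 1 v] by simp
      also have "exp (- 1 :: real) \<le> 1 / 2"
        using exp_ge_add_one_self[of 1] by (simp add: exp_minus field_simps)
      finally have m2: "1 \<le> 2 * norm (1 - q)"
        using norm_triangle_ineq2[of 1 q] by simp
      have "norm w ^ Suc L * 1 \<le> (2 * v) ^ Suc L * (2 * norm (1 - q)) ^ Suc L"
        using w2 m2 v by (intro mult_mono power_mono one_le_power) auto
      then have "norm q * (norm w ^ Suc L * 1) \<le> norm q * ((2 * v) ^ Suc L * (2 * norm (1 - q)) ^ Suc L)"
        by (intro mult_left_mono) auto
      also have "\<dots> = 4 ^ Suc L * (v ^ Suc L * norm q) * norm (1 - q) ^ Suc L"
      proof -
        have "2 * v * (2 * norm (1 - q)) = 4 * (v * norm (1 - q))" by simp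
        then have "(2 * v) ^ Suc L * (2 * norm (1 - q)) ^ Suc L = (4 * (v * norm (1 - q))) ^ Suc L"
          unfolding power_mult_distrib[symmetric] by (simp only:)
        then show ?thesis by (simp only: power_mult_distrib mult_ac)
      qed
      also have "v ^ Suc L * norm q \<le> E"
        using E(2)[OF v] v by (simp add: nq powr_realpow[symmetric] del: power_Suc)
      then have "4 ^ Suc L * (v ^ Suc L * norm q) * norm (1 - q) ^ Suc L \<le> 4 ^ Suc L * E * norm (1 - q) ^ Suc L"
        by (intro mult_right_mono mult_left_mono) auto
      finally have "norm q * norm w ^ Suc L * D \<le> 4 ^ Suc L * E * norm (1 - q) ^ Suc L * D"
        using D(1) by (intro mult_right_mono) auto
      also have "\<dots> = (D * 4 ^ Suc L * E) * norm (1 - q) ^ Suc L"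
        by (simp only: mult_ac)
      also have "\<dots> \<le> C * norm (1 - q) ^ Suc L"
        by (intro mult_right_mono) (auto simp: C_def)
      finally show ?thesis .
    qed
    then have "D * norm q / norm (1 - q) ^ Suc L \<le> C / norm w ^ Suc L"
      using m w0 by (simp add: divide_simps mult_ac del: power_Suc)
    then show "norm (power_powser L (exp (2 * of_real pi * \<i> * w))) \<le> C / norm w ^ Suc L"
      using D(2)[OF q1] unfolding q_def by (rule order.trans[rotated])
  qed
qed

section \<open>The kernel of real order\<close>

lemma has_bochner_integral_shifted_powr:
  fixes a s :: real
  assumes "a > 0" "s > 0"
  shows "has_bochner_integral (lebesgue_on {0<..}) (\<lambda>u. (a + u) powr (- s - 1)) (a powr (- s) / s)"
proof -
  have "((\<lambda>x. x powr (- s - 1)) has_integral - (a powr (- s - 1 + 1)) / (- s - 1 + 1)) {a..}"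
    by (rule has_integral_powr_to_inf) (use assms in auto)
  then have "((\<lambda>x. x powr (- s - 1)) has_integral a powr (- s) / s) {a..}"
    by simp
  then have I: "((\<lambda>x. x powr (- s - 1)) has_integral a powr (- s) / s) {a<..}"
  proof (rule has_integral_spike_set_eq[THEN iffD1, rotated -1])
    show "negligible {x \<in> {a..} - {a<..}. x powr (- s - 1) \<noteq> 0}"
      by (rule negligible_subset[of "{a}"]) auto
    show "negligible {x \<in> {a<..} - {a..}. x powr (- s - 1) \<noteq> 0}"
      by (rule negligible_subset[of "{}"]) auto
  qed
  then have "(\<lambda>x. x powr (- s - 1)) absolutely_integrable_on {a<..}"
    by (intro nonnegative_absolutely_integrable_1) (auto simp: integrable_on_def)
  then have "has_bochner_integral (lebesgue_on {a<..}) (\<lambda>x. x powr (- s - 1)) (a powr (- s) / s)"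
    using I by (simp add: has_bochner_integral_iff lebesgue_integral_eq_integral integral_unique
        integrable_restrict_space set_integrable_def)
  then have "has_bochner_integral lebesgue (\<lambda>x. indicator {a<..} x *\<^sub>R (x powr (- s - 1))) (a powr (- s) / s)"
    by (subst (asm) has_bochner_integral_restrict_space) auto
  then have "has_bochner_integral lebesgue (\<lambda>u. indicator {a<..} (a + 1 * u) *\<^sub>R ((a + 1 * u) powr (- s - 1))) ((a powr (- s) / s) /\<^sub>R \<bar>1\<bar>)"
    by (subst (asm) has_bochner_integral_lebesgue_real_affine_iff[of 1 _ _ a]) auto
  moreover have "(\<lambda>u. indicator {a<..} (a + 1 * u) *\<^sub>R ((a + 1 * u) powr (- s - 1)))
      = (\<lambda>u. indicator {0<..} u *\<^sub>R ((a + u) powr (- s - 1)))"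
    by (auto simp: indicator_def fun_eq_iff)
  ultimately show ?thesis
    by (subst has_bochner_integral_restrict_space) auto
qed

text \<open>The polylogarithm of order \<open>- s\<close> at \<open>exp (2 * pi * i * w)\<close>;
  its coefficients undo the division by \<open>n powr s\<close> in the sine series.\<close>

definition frac_kernel :: "real \<Rightarrow> complex \<Rightarrow> complex" where
  "frac_kernel s w = (\<Sum>n. of_real (real (Suc n) powr s) * exp (2 * of_real pi * \<i> * of_nat (Suc n) * w))"

lemma frac_kernel_summable:
  assumes "s \<ge> 0" "Im w > 0"
  shows "summable (\<lambda>n. norm (of_real (real (Suc n) powr s) * exp (2 * of_real pi * \<i> * of_nat (Suc n) * w)))"
proof -
  have "summable (\<lambda>n. real (Suc n) powr s * exp (- (2 * pi * Im w) * real (Suc n)))"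
    using summable_powr_exp[of s "2 * pi * Im w"] assms by (subst summable_Suc_iff) simp
  then show ?thesis by (simp add: norm_mult mult_ac)
qed

text \<open>For natural \<open>L \<ge> s + 1\<close>, the kernel with exponent \<open>s\<close> is a fractional integral of the
  rational function \<open>power_powser L\<close> of \<open>exp (2 * pi * i * w)\<close>.\<close>

lemma frac_kernel_bound:
  assumes s: "s > 0"
  obtains C where "C > 0" "\<And>w. \<bar>Re w\<bar> \<le> 1 / 2 \<Longrightarrow> Im w > 0 \<Longrightarrow>
    norm (frac_kernel s w) \<le> C * norm w powr (- s - 1)"
proof -
  define L where "L = nat \<lceil>s + 1\<rceil>"
  \<comment> \<open>A Gamma integral of order \<open>p\<close> divides the coefficient
    \<open>n ^ L\<close> by \<open>n powr p\<close> and leaves \<open>n powr s\<close>. Having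
    \<open>p \<ge> 1\<close> makes \<open>u powr (p - 1)\<close> monotone, so that \<open>u\<close>
    may be enlarged to \<open>norm w + u\<close>.\<close>
  define p where "p = real L - s"
  have Ls: "real L \<ge> s + 1" using s by (simp add: L_def of_nat_nat)
  then have L: "L > 0" and p: "p \<ge> 1" using s by (auto simp: p_def)
  obtain D where D: "D > 0" "\<And>w. \<bar>Re w\<bar> \<le> 1 / 2 \<Longrightarrow> Im w > 0 \<Longrightarrow>
    norm (power_powser L (exp (2 * of_real pi * \<i> * w))) \<le> D / norm w ^ Suc L"
    using power_powser_strip_bound[OF L] by blast
  let ?L = "lebesgue_on {0::real<..}"
  define g where "g = Gamma p / (2 * pi) powr p"
  have g: "g > 0" using p Gamma_real_pos[of p] by (simp add: g_def)
  define C where "C = D * 2 ^ Suc L / (s + 1) / g"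
  show ?thesis
  proof (rule that[of C])
    show "C > 0" using D g s by (simp add: C_def)
    fix w assume w: "\<bar>Re w\<bar> \<le> 1 / 2" "Im w > 0"
    have w0: "norm w > 0" using w by auto
    define a where "a n = of_nat (Suc n) ^ L * exp (2 * of_real pi * \<i> * of_nat (Suc n) * w)" for n
    have a_div: "a n / of_real (real (Suc n) powr p) = of_real (real (Suc n) powr s) * exp (2 * of_real pi * \<i> * of_nat (Suc n) * w)" for n
    proof -
      have "real (Suc n) ^ L = real (Suc n) powr s * real (Suc n) powr p"
        by (simp add: p_def powr_add[symmetric] powr_realpow[symmetric] del: power_Suc of_nat_Suc)
      then have "complex_of_real (real (Suc n) ^ L) = of_real (real (Suc n) powr s * real (Suc n) powr p)"
        by (rule arg_cong)
      then show ?thesis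
        by (simp add: a_def del: of_nat_Suc)
    qed
    have sum_a: "summable (\<lambda>n. norm (a n) / real (Suc n) powr p)"
    proof -
      have "norm (a n) / real (Suc n) powr p = norm (a n / of_real (real (Suc n) powr p))" for n
        by (simp add: norm_divide)
      then show ?thesis unfolding a_div using frac_kernel_summable[of s w] s w by simp
    qed
    have A: "(\<lambda>n. a n * of_real (exp (- 2 * pi * real (Suc n) * u))) sums
        power_powser L (exp (2 * of_real pi * \<i> * (w + \<i> * of_real u)))" if "u > 0" for u
    proof -
      let ?q = "exp (2 * of_real pi * \<i> * (w + \<i> * of_real u))"
      have "norm ?q < 1" unfolding norm_exp_2pi_i_eq using that w by simp
      then have "(\<lambda>n. of_nat (Suc n) ^ L * ?q ^ Suc n) sums power_powser L ?q"
        using power_powser_sums[of ?q L] L by (subst sums_Suc_iff) (simp add: zero_power)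
      moreover have "?q ^ Suc n = exp (2 * of_real pi * \<i> * of_nat (Suc n) * w) * of_real (exp (- 2 * pi * real (Suc n) * u))" for n
      proof -
        have "of_nat (Suc n) * (2 * of_real pi * \<i> * (w + \<i> * of_real u))
           = 2 * of_real pi * \<i> * of_nat (Suc n) * w + of_real (- 2 * pi * real (Suc n) * u)"
          by (simp add: distrib_left mult_ac) (simp add: algebra_simps)
        then show ?thesis by (simp only: exp_of_nat_mult[symmetric] exp_add exp_of_real)
      qed
      ultimately show ?thesis by (simp only: a_def mult.assoc)
    qed
    have hbi: "has_bochner_integral ?L
        (\<lambda>u. of_real (u powr (p - 1)) * power_powser L (exp (2 * of_real pi * \<i> * (w + \<i> * of_real u))))
        (of_real g * frac_kernel s w)"
      using has_bochner_integral_Gamma_series[OF _ sum_a A] p unfolding a_div g_def frac_kernel_def by simp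
    have B: "has_bochner_integral ?L (\<lambda>u. D * 2 ^ Suc L * (norm w + u) powr (- (s + 1) - 1))
        (D * 2 ^ Suc L * (norm w powr (- (s + 1)) / (s + 1)))"
      using s w0 by (intro has_bochner_integral_mult_right has_bochner_integral_shifted_powr) auto
    have "norm (of_real g * frac_kernel s w) \<le> D * 2 ^ Suc L * (norm w powr (- (s + 1)) / (s + 1))"
      unfolding has_bochner_integral_integral_eq[OF hbi, symmetric] has_bochner_integral_integral_eq[OF B, symmetric]
    proof (rule order.trans[OF integral_norm_bound integral_mono])
      show "integrable ?L (\<lambda>u. D * 2 ^ Suc L * (norm w + u) powr (- (s + 1) - 1))"
        using B by (simp add: has_bochner_integral_iff)
      show "integrable ?L (\<lambda>u. norm (of_real (u powr (p - 1)) * power_powser L (exp (2 * of_real pi * \<i> * (w + \<i> * of_real u)))))"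
        using hbi by (intro integrable_norm) (simp only: has_bochner_integral_iff)
      fix u assume "u \<in> space ?L"
      then have u: "u > 0" by simp
      let ?w = "w + \<i> * of_real u"
      have "(Im w)\<^sup>2 \<le> (Im w + u)\<^sup>2"
        using w u by (intro power_mono) auto
      then have "(norm w)\<^sup>2 \<le> (norm ?w)\<^sup>2"
        unfolding cmod_power2 by simp
      then have "norm w \<le> norm ?w"
        by (rule power2_le_imp_le) (rule norm_ge_zero)
      moreover have "u \<le> norm ?w"
        using abs_Im_le_cmod[of ?w] w by simp
      \<comment> \<open>Moving up by \<open>u\<close> brings the point no closer to 0 than either
        \<open>norm w\<close> or \<open>u\<close>, so their mean is a lower bound. The integrand is
        then controlled by \<open>(norm w + u) powr (- s - 2)\<close>, whose integral has the
        desired order.\<close>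
      ultimately have nw: "(norm w + u) / 2 \<le> norm ?w" by simp
      define b where "b = norm w + u"
      have b: "b > 0" using w0 u unfolding b_def by linarith
      have "norm (of_real (u powr (p - 1)) * power_powser L (exp (2 * of_real pi * \<i> * ?w)))
         = u powr (p - 1) * norm (power_powser L (exp (2 * of_real pi * \<i> * ?w)))"
        by (simp add: norm_mult)
      also have "\<dots> \<le> b powr (p - 1) * (D / (b / 2) ^ Suc L)"
      proof (intro mult_mono)
        show "u powr (p - 1) \<le> b powr (p - 1)"
          using u p w0 by (intro powr_mono2) (auto simp: b_def)
        have "norm (power_powser L (exp (2 * of_real pi * \<i> * ?w))) \<le> D / norm ?w ^ Suc L"
          using w u by (intro D(2)) auto
        also have "\<dots> \<le> D / (b / 2) ^ Suc L"
          using D(1) b nw by (intro divide_left_mono power_mono mult_pos_pos zero_less_power) (auto simp: b_def)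
        finally show "norm (power_powser L (exp (2 * of_real pi * \<i> * ?w))) \<le> D / (b / 2) ^ Suc L" .
      qed auto
      also have "\<dots> = D * 2 ^ Suc L * (b powr (p - 1) / b powr real (Suc L))"
        using b by (simp add: power_divide powr_realpow del: power_Suc of_nat_Suc)
      also have "b powr (p - 1) / b powr real (Suc L) = b powr (- (s + 1) - 1)"
        by (simp add: powr_diff[symmetric] p_def)
      finally show "norm (of_real (u powr (p - 1)) * power_powser L (exp (2 * of_real pi * \<i> * ?w)))
          \<le> D * 2 ^ Suc L * (norm w + u) powr (- (s + 1) - 1)"
        by (simp add: b_def)
    qed
    then have "g * norm (frac_kernel s w) \<le> D * 2 ^ Suc L * (norm w powr (- s - 1) / (s + 1))"
      using g by (simp add: norm_mult)
    then have "g * norm (frac_kernel s w) / g \<le> D * 2 ^ Suc L * (norm w powr (- s - 1) / (s + 1)) / g"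
      using g by (intro divide_right_mono) auto
    then show "norm (frac_kernel s w) \<le> C * norm w powr (- s - 1)"
      using g by (simp add: C_def mult_ac)
  qed
qed

section \<open>Recovering the form from its sine series\<close>

lemma continuous_on_cis_linear: "continuous_on A (\<lambda>t::real. cis (b * t))"
  by (intro continuous_intros)

lemma integral_cis_period:
  fixes k :: int and a :: real
  shows "integral\<^sup>L (lebesgue_on {a..a + 1}) (\<lambda>t. cis (2 * pi * of_int k * t)) = (if k = 0 then 1 else 0)"
proof -
  have int: "integrable (lebesgue_on {a..a + 1}) (\<lambda>t. cis (2 * pi * of_int k * t))"
    by (intro continuous_imp_integrable_real continuous_on_cis_linear)
  have "((\<lambda>t. cis (2 * pi * of_int k * t)) has_integral (if k = 0 then 1 else 0)) {a..a + 1}"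
  proof (cases "k = 0")
    case True
    then show ?thesis using has_integral_const_real[of "1::complex" a "a + 1"] by simp
  next
    case False
    define b where "b = 2 * pi * of_int k"
    have b: "b \<noteq> 0" using False by (simp add: b_def)
    let ?F = "\<lambda>t. - \<i> * cis (b * t) / of_real b"
    have "((\<lambda>t. cis (b * t)) has_integral (?F (a + 1) - ?F a)) {a..a + 1}"
    proof (rule fundamental_theorem_of_calculus)
      fix t assume "t \<in> {a..a + 1}"
      have "(?F has_vector_derivative (- \<i> * (b *\<^sub>R (\<i> * cis (b * t))) / of_real b)) (at t within {a..a + 1})"
        unfolding cis_conv_exp
        by (rule derivative_eq_intros has_vector_derivative_real_field | simp)+ (simp add: scaleR_conv_of_real algebra_simps)
      then show "(?F has_vector_derivative cis (b * t)) (at t within {a..a + 1})"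
        using b by (simp add: scaleR_conv_of_real)
    qed auto
    moreover have "cis (b * (a + 1)) = cis (b * a)"
    proof -
      have "cis (b * (a + 1)) = cis (b * a) * cis b" by (simp add: cis_mult distrib_left)
      also have "cis b = 1" unfolding b_def by (rule cis_multiple_2pi) auto
      finally show ?thesis by simp
    qed
    ultimately show ?thesis using False by (simp add: b_def)
  qed
  then show ?thesis
    unfolding lebesgue_integral_eq_integral[OF int, simplified] by (rule integral_unique)
qed

lemma integral_series_unit_interval:
  fixes c :: "nat \<Rightarrow> complex" and \<phi> :: "nat \<Rightarrow> real \<Rightarrow> complex"
  assumes c: "summable (\<lambda>n. norm (c n))"
    and meas: "\<And>n. \<phi> n \<in> borel_measurable (lebesgue_on {a..a + 1})"
    and bound: "\<And>n t. t \<in> {a..a + 1} \<Longrightarrow> norm (\<phi> n t) \<le> B"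
  shows "integrable (lebesgue_on {a..a + 1}) (\<lambda>t. \<Sum>n. c n * \<phi> n t)"
    and "(\<lambda>n. c n * integral\<^sup>L (lebesgue_on {a..a + 1}) (\<phi> n)) sums
      integral\<^sup>L (lebesgue_on {a..a + 1}) (\<lambda>t. \<Sum>n. c n * \<phi> n t)"
proof -
  let ?I = "lebesgue_on {a..a + 1}"
  interpret finite_measure ?I
    by (rule finite_measureI) (simp add: emeasure_restrict_space)
  have const: "integrable ?I (\<lambda>t. B)" "integral\<^sup>L ?I (\<lambda>t. B) = B"
    by (auto simp: measure_restrict_space)
  have int: "integrable ?I (\<phi> n)" for n
    by (rule Bochner_Integration.integrable_bound[OF const(1) meas]) (use bound in \<open>auto intro!: AE_I2 order.trans[OF bound]\<close>)
  have int_c: "integrable ?I (\<lambda>t. c n * \<phi> n t)" for n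
    by (intro integrable_mult_right int)
  have le: "norm (c n * \<phi> n t) \<le> B * norm (c n)" if "t \<in> {a..a + 1}" for n t
    using mult_left_mono[OF bound[OF that, of n], of "norm (c n)"] by (simp add: norm_mult mult.commute)
  have AE: "AE t in ?I. summable (\<lambda>n. norm (c n * \<phi> n t))"
  proof (rule AE_I2)
    fix t assume "t \<in> space ?I"
    then have t: "t \<in> {a..a + 1}" by simp
    show "summable (\<lambda>n. norm (c n * \<phi> n t))"
      by (rule summable_comparison_test'[OF summable_mult[OF c, of B], of 0]) (use le[OF t] in auto)
  qed
  have sum: "summable (\<lambda>n. integral\<^sup>L ?I (\<lambda>t. norm (c n * \<phi> n t)))"
  proof (rule summable_comparison_test'[OF summable_mult[OF c, of B], of 0])
    fix n :: nat
    have "integral\<^sup>L ?I (\<lambda>t. norm (c n * \<phi> n t)) \<le> integral\<^sup>L ?I (\<lambda>t. B * norm (c n))"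
      using int_c[of n] le by (intro integral_mono) auto
    also have "\<dots> = B * norm (c n)"
      by (simp add: measure_restrict_space)
    finally show "norm (integral\<^sup>L ?I (\<lambda>t. norm (c n * \<phi> n t))) \<le> B * norm (c n)"
      by simp
  qed
  show "integrable ?I (\<lambda>t. \<Sum>n. c n * \<phi> n t)"
    by (rule integrable_suminf[OF int_c AE sum])
  show "(\<lambda>n. c n * integral\<^sup>L ?I (\<phi> n)) sums integral\<^sup>L ?I (\<lambda>t. \<Sum>n. c n * \<phi> n t)"
    using sums_integral[OF int_c AE sum] by simp
qed

text \<open>The sine contributes frequencies of both signs, but multiplication by a negative
  frequency leaves a constant term only from \<open>n = m\<close>. The starting point
  \<open>a\<close> of the period is free because the period will be centred at
  \<open>Re z\<close>.\<close>

lemma sine_series_fourier_coefficient: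
  assumes summable: "summable (\<lambda>n. norm (r (Suc n)) / real (Suc n) powr s)"
  shows "integral\<^sup>L (lebesgue_on {a..a + 1}) (\<lambda>t. sine_series r s t * cis (- 2 * pi * real (Suc m) * t))
    = r (Suc m) / of_real (real (Suc m) powr s) / (2 * \<i>)"
proof -
  let ?I = "lebesgue_on {a..a + 1}"
  define c where "c n = r (Suc n) / of_real (real (Suc n) powr s)" for n
  have c: "summable (\<lambda>n. norm (c n))" using summable by (simp add: c_def norm_divide)
  define \<phi> where "\<phi> n t = of_real (sin (2 * pi * real (Suc n) * t)) * cis (- 2 * pi * real (Suc m) * t)" for n t
  \<comment> \<open>Both indices are shifted by \<open>Suc\<close>: the shifts cancel in the first
    frequency and add up to 2 in the second, which is therefore never zero.\<close>
  have \<phi>: "\<phi> n t = (cis (2 * pi * of_int (int n - int m) * t) - cis (2 * pi * of_int (- int n - int m - 2) * t)) / (2 * \<i>)" for n t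
  proof -
    have "complex_of_real (sin \<theta>) = (cis \<theta> - cis (- \<theta>)) / (2 * \<i>)" for \<theta>
      by (auto simp: complex_eq_iff)
    then have "\<phi> n t = (cis (2 * pi * real (Suc n) * t) - cis (- (2 * pi * real (Suc n) * t))) / (2 * \<i>) * cis (- 2 * pi * real (Suc m) * t)"
      by (simp only: \<phi>_def)
    also have "\<dots> = (cis (2 * pi * real (Suc n) * t) * cis (- 2 * pi * real (Suc m) * t)
        - cis (- (2 * pi * real (Suc n) * t)) * cis (- 2 * pi * real (Suc m) * t)) / (2 * \<i>)"
      by (simp only: times_divide_eq_left left_diff_distrib)
    also have "cis (2 * pi * real (Suc n) * t) * cis (- 2 * pi * real (Suc m) * t) = cis (2 * pi * of_int (int n - int m) * t)"
      unfolding cis_mult by (rule arg_cong[of _ _ cis]) (simp add: algebra_simps)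
    also have "cis (- (2 * pi * real (Suc n) * t)) * cis (- 2 * pi * real (Suc m) * t) = cis (2 * pi * of_int (- int n - int m - 2) * t)"
      unfolding cis_mult by (rule arg_cong[of _ _ cis]) (simp add: algebra_simps)
    finally show ?thesis .
  qed
  have meas: "\<phi> n \<in> borel_measurable ?I" for n
    unfolding \<phi>_def[abs_def] by (intro continuous_imp_measurable_on_sets_lebesgue continuous_intros) auto
  have bd: "norm (\<phi> n t) \<le> 1" for n t
    by (simp add: \<phi>_def norm_mult)
  have I: "integral\<^sup>L ?I (\<phi> n) = (if n = m then 1 / (2 * \<i>) else 0)" for n
  proof -
    have int: "integrable ?I (\<lambda>t. cis (2 * pi * of_int k * t))" for k
      by (intro continuous_imp_integrable_real continuous_on_cis_linear)
    show ?thesis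
      unfolding \<phi>[abs_def] integral_divide_zero
      unfolding Bochner_Integration.integral_diff[OF int int] integral_cis_period by simp
  qed
  have "(\<lambda>n. c n * (if n = m then 1 / (2 * \<i>) else 0)) sums integral\<^sup>L ?I (\<lambda>t. \<Sum>n. c n * \<phi> n t)"
    using integral_series_unit_interval(2)[OF c meas bd] by (simp only: I)
  moreover have "(\<lambda>n. c n * (if n = m then 1 / (2 * \<i>) else 0)) = (\<lambda>n. if n = m then c m / (2 * \<i>) else 0)"
    by auto
  ultimately have "integral\<^sup>L ?I (\<lambda>t. \<Sum>n. c n * \<phi> n t) = c m / (2 * \<i>)"
    using sums_single[of m "\<lambda>_. c m / (2 * \<i>)"] sums_unique2 by (metis (no_types, lifting))
  moreover have "(\<Sum>n. c n * \<phi> n t) = sine_series r s t * cis (- 2 * pi * real (Suc m) * t)" for t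
  proof -
    have "summable (\<lambda>n. c n * of_real (sin (2 * pi * real (Suc n) * t)))"
      by (rule summable_comparison_test'[OF c, of 0]) (simp add: norm_mult mult_left_le)
    then show ?thesis
      unfolding sine_series_def \<phi>_def c_def[symmetric] mult.assoc[symmetric] by (rule suminf_mult2[symmetric])
  qed
  ultimately show ?thesis by (simp add: c_def)
qed

lemma sine_series_measurable:
  "sine_series r s \<in> borel_measurable (lebesgue_on A)"
proof -
  have "sine_series r s \<in> borel_measurable borel"
    unfolding sine_series_def[abs_def] by measurable
  then show ?thesis
    by (intro measurable_restrict_space1 measurable_completion) simp
qed

lemma sine_series_bounded:
  assumes "summable (\<lambda>n. norm (r (Suc n)) / real (Suc n) powr s)"
  obtains B where "\<And>t. norm (sine_series r s t) \<le> B"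
proof (rule that)
  fix t
  show "norm (sine_series r s t) \<le> (\<Sum>n. norm (r (Suc n)) / real (Suc n) powr s)"
    unfolding sine_series_def
    by (intro norm_suminf_le assms) (simp add: norm_mult norm_divide mult_left_le divide_right_mono)
qed

text \<open>All frequencies are \<open>- i - m - 1\<close>, hence strictly negative. This is why the
  approximating polynomial is taken in \<open>cis (- 2 * pi * (t - x))\<close>.\<close>

lemma trig_poly_fourier_coefficient:
  fixes Q :: "complex poly"
  shows "integral\<^sup>L (lebesgue_on {a..a + 1}) (\<lambda>t. poly Q (cis (- 2 * pi * (t - x))) * cis (- 2 * pi * real (Suc m) * t)) = 0"
proof -
  let ?I = "lebesgue_on {a..a + 1}"
  have int: "integrable ?I (\<lambda>t. cis (2 * pi * of_int k * t))" for k
    by (intro continuous_imp_integrable_real continuous_on_cis_linear)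
  have eq: "poly Q (cis (- 2 * pi * (t - x))) * cis (- 2 * pi * real (Suc m) * t)
    = (\<Sum>i\<le>degree Q. (coeff Q i * cis (2 * pi * real i * x)) * cis (2 * pi * of_int (- int i - int m - 1) * t))" for t
    unfolding poly_altdef sum_distrib_right
    by (intro sum.cong refl) (simp add: Complex.DeMoivre cis_mult mult.assoc algebra_simps)
  have "integral\<^sup>L ?I (\<lambda>t. \<Sum>i\<le>degree Q. (coeff Q i * cis (2 * pi * real i * x)) * cis (2 * pi * of_int (- int i - int m - 1) * t))
    = (\<Sum>i\<le>degree Q. (coeff Q i * cis (2 * pi * real i * x)) * integral\<^sup>L ?I (\<lambda>t. cis (2 * pi * of_int (- int i - int m - 1) * t)))"
    by (subst Bochner_Integration.integral_sum) (intro integrable_mult_right int, simp only: integral_mult_right_zero)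
  also have "\<dots> = 0"
    unfolding integral_cis_period by (intro sum.neutral) auto
  finally show ?thesis unfolding eq .
qed

lemma norm_poly_cis_le:
  fixes Q :: "complex poly"
  shows "norm (poly Q (cis \<theta>)) \<le> (\<Sum>i\<le>degree Q. norm (coeff Q i))"
  unfolding poly_altdef by (rule sum_norm_le) (simp add: norm_mult norm_power)

text \<open>The \<open>n\<close>-th kernel term extracts the Fourier coefficient
  \<open>r n / n powr s / (2 * \<i>)\<close> and multiplies it by \<open>n powr s\<close>.
  Subtracting the trigonometric polynomial leaves the integral unchanged; a suitable
  \<open>Q\<close> makes \<open>g\<close> small near \<open>x\<close>.\<close>

lemma fourier_form_eq_kernel_integral:
  fixes Q :: "complex poly" and x a :: real
  assumes F: "has_fourier_expansion M r" "r 0 = 0" and s: "s > 0"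
    and summable: "summable (\<lambda>n. norm (r (Suc n)) / real (Suc n) powr s)"
    and z: "z \<in> upper_half_plane"
  defines "g \<equiv> \<lambda>t. sine_series r s t - poly Q (cis (- 2 * pi * (t - x)))"
  shows "integrable (lebesgue_on {a..a + 1}) (\<lambda>t. g t * frac_kernel s (z - of_real t))"
    and "M z = 2 * \<i> * integral\<^sup>L (lebesgue_on {a..a + 1}) (\<lambda>t. g t * frac_kernel s (z - of_real t))"
proof -
  let ?I = "lebesgue_on {a..a + 1}"
  have y: "Im z > 0" using z by (simp add: upper_half_plane_def)
  define c where "c n = of_real (real (Suc n) powr s) * exp (2 * of_real pi * \<i> * of_nat (Suc n) * z)" for n
  define \<psi> where "\<psi> n t = cis (- 2 * pi * real (Suc n) * t)" for n t
  have c: "summable (\<lambda>n. norm (c n))"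
    unfolding c_def by (rule frac_kernel_summable) (use s y in auto)
  obtain B where B: "\<And>t. norm (sine_series r s t) \<le> B"
    using sine_series_bounded[OF summable] by blast
  have g_le: "norm (g t) \<le> B + (\<Sum>i\<le>degree Q. norm (coeff Q i))" for t
    unfolding g_def by (rule order.trans[OF norm_triangle_ineq4 add_mono[OF B norm_poly_cis_le]])
  have cont_T: "continuous_on A (\<lambda>t. poly Q (cis (- 2 * pi * (t - x))))" for A :: "real set"
    by (intro continuous_intros)
  have g_meas: "g \<in> borel_measurable ?I"
    unfolding g_def
    by (intro borel_measurable_diff sine_series_measurable continuous_imp_measurable_on_sets_lebesgue cont_T) auto
  have \<psi>_cont: "continuous_on A (\<psi> n)" for n A
    unfolding \<psi>_def by (intro continuous_intros)
  have \<psi>_meas: "\<psi> n \<in> borel_measurable ?I" for n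
    by (intro continuous_imp_measurable_on_sets_lebesgue \<psi>_cont) auto
  have meas: "(\<lambda>t. g t * \<psi> n t) \<in> borel_measurable ?I" for n
    by (intro borel_measurable_times g_meas \<psi>_meas)
  have bound: "norm (g t * \<psi> n t) \<le> B + (\<Sum>i\<le>degree Q. norm (coeff Q i))" for n t
    using g_le[of t] by (simp add: norm_mult \<psi>_def)
  have kernel: "(\<Sum>n. c n * (g t * \<psi> n t)) = g t * frac_kernel s (z - of_real t)" for t
  proof -
    have e: "of_real (real (Suc n) powr s) * exp (2 * of_real pi * \<i> * of_nat (Suc n) * (z - of_real t)) = c n * \<psi> n t" for n
    proof -
      have "2 * of_real pi * \<i> * of_nat (Suc n) * (z - of_real t)
         = 2 * of_real pi * \<i> * of_nat (Suc n) * z + \<i> * of_real (- 2 * pi * real (Suc n) * t)"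
        by (simp add: right_diff_distrib)
      then show ?thesis by (simp only: c_def \<psi>_def cis_conv_exp exp_add mult.assoc)
    qed
    have "summable (\<lambda>n. c n * \<psi> n t)"
      by (rule summable_norm_cancel) (use c in \<open>simp add: norm_mult \<psi>_def\<close>)
    then have "(\<Sum>n. g t * (c n * \<psi> n t)) = g t * frac_kernel s (z - of_real t)"
      unfolding frac_kernel_def e by (rule suminf_mult)
    then show ?thesis by (simp only: mult_ac)
  qed
  have "integral\<^sup>L ?I (\<lambda>t. g t * \<psi> n t) = r (Suc n) / of_real (real (Suc n) powr s) / (2 * \<i>)" for n
  proof -
    have int1: "integrable ?I (\<lambda>t. sine_series r s t * \<psi> n t)"
    proof -
      interpret finite_measure ?I
        by (rule finite_measureI) (simp add: emeasure_restrict_space)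
      show ?thesis
      proof (rule integrable_const_bound[of _ B])
        show "(\<lambda>t. sine_series r s t * \<psi> n t) \<in> borel_measurable ?I"
          by (intro borel_measurable_times sine_series_measurable \<psi>_meas)
        show "AE t in ?I. norm (sine_series r s t * \<psi> n t) \<le> B"
          using B by (simp add: norm_mult \<psi>_def)
      qed
    qed
    have int2: "integrable ?I (\<lambda>t. poly Q (cis (- 2 * pi * (t - x))) * \<psi> n t)"
      by (intro continuous_imp_integrable_real continuous_on_mult cont_T \<psi>_cont)
    have "integral\<^sup>L ?I (\<lambda>t. g t * \<psi> n t)
      = integral\<^sup>L ?I (\<lambda>t. sine_series r s t * \<psi> n t) - integral\<^sup>L ?I (\<lambda>t. poly Q (cis (- 2 * pi * (t - x))) * \<psi> n t)"
      unfolding g_def left_diff_distrib by (rule Bochner_Integration.integral_diff[OF int1 int2])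
    then show ?thesis
      unfolding \<psi>_def sine_series_fourier_coefficient[OF summable] trig_poly_fourier_coefficient by simp
  qed
  then have sums1: "(\<lambda>n. c n * (r (Suc n) / of_real (real (Suc n) powr s) / (2 * \<i>))) sums
      integral\<^sup>L ?I (\<lambda>t. g t * frac_kernel s (z - of_real t))"
    using integral_series_unit_interval(2)[of c "\<lambda>n t. g t * \<psi> n t", OF c meas bound] by (simp only: kernel)
  show "integrable ?I (\<lambda>t. g t * frac_kernel s (z - of_real t))"
    using integral_series_unit_interval(1)[of c "\<lambda>n t. g t * \<psi> n t", OF c meas bound] by (simp only: kernel)
  have "(\<lambda>n. r n * exp (2 * of_real pi * \<i> * of_nat n * z)) sums M z"
    using F(1) z unfolding has_fourier_expansion_def by blast
  then have "(\<lambda>n. r (Suc n) * exp (2 * of_real pi * \<i> * of_nat (Suc n) * z)) sums M z"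
    by (subst sums_Suc_iff) (simp add: F(2))
  moreover have "2 * \<i> * (c n * (r (Suc n) / of_real (real (Suc n) powr s) / (2 * \<i>)))
      = r (Suc n) * exp (2 * of_real pi * \<i> * of_nat (Suc n) * z)" for n
  proof -
    have key: "j * (p * E * (R / p / j)) = R * E" if "p \<noteq> 0" "j \<noteq> 0" for j p E R :: complex
      using that by simp
    show ?thesis unfolding c_def by (rule key) auto
  qed
  then have "(\<lambda>n. r (Suc n) * exp (2 * of_real pi * \<i> * of_nat (Suc n) * z)) sums
      (2 * \<i> * integral\<^sup>L ?I (\<lambda>t. g t * frac_kernel s (z - of_real t)))"
    using sums_mult[OF sums1, of "2 * \<i>"] by (simp only:)
  ultimately show "M z = 2 * \<i> * integral\<^sup>L ?I (\<lambda>t. g t * frac_kernel s (z - of_real t))"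
    by (rule sums_unique2)
qed

section \<open>From the Hoelder polynomial to a trigonometric polynomial\<close>

lemma norm_cis_minus_one_le: "norm (cis x - 1) \<le> \<bar>x\<bar>"
proof -
  have "norm (cis x - 1) = 2 * \<bar>sin (x / 2)\<bar>"
    using dist_exp_i_1[of x] by (simp add: dist_norm cis_conv_exp)
  also have "\<dots> \<le> \<bar>x\<bar>"
    using abs_sin_x_le_abs_x[of "x / 2"] by simp
  finally show ?thesis .
qed

text \<open>A polynomial in \<open>u\<close> is a holomorphic function of \<open>exp (- 2 * pi * i * u)\<close> near \<open>1\<close>; the
  trigonometric polynomial comes from its Taylor expansion there.\<close>

lemma poly_trig_approx:
  fixes P :: "complex poly" and N :: nat
  obtains Q :: "complex poly" and C :: real where
    "\<And>u. \<bar>u\<bar> < 1 / 16 \<Longrightarrow> norm (poly P (of_real u) - poly Q (cis (- 2 * pi * u))) \<le> C * \<bar>u\<bar> ^ Suc N"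
proof -
  \<comment> \<open>For small real \<open>u\<close> the argument of \<open>P\<close> recovers
    \<open>u\<close> from \<open>q = cis (- 2 * pi * u)\<close>.\<close>
  define G where "G q = poly P (\<i> * Ln q / of_real (2 * pi))" for q
  have sub: "ball (1::complex) 1 \<subseteq> - \<real>\<^sub>\<le>\<^sub>0"
  proof
    fix q :: complex assume "q \<in> ball 1 1"
    then have "norm (1 - q) < 1" by (simp add: dist_norm)
    then have "Re q > 0" using abs_Re_le_cmod[of "1 - q"] by simp
    then show "q \<in> - \<real>\<^sub>\<le>\<^sub>0" by (auto simp: complex_nonpos_Reals_iff)
  qed
  have hol: "G holomorphic_on ball 1 1"
    unfolding G_def poly_altdef using sub by (intro holomorphic_intros) auto
  have "compact ((deriv ^^ Suc N) G ` cball 1 (1 / 2))"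
  proof (rule compact_continuous_image)
    show "continuous_on (cball 1 (1 / 2)) ((deriv ^^ Suc N) G)"
      by (rule continuous_on_subset[OF holomorphic_on_imp_continuous_on[OF holomorphic_higher_deriv[OF hol]]]) auto
  qed auto
  then obtain B where "\<forall>v \<in> (deriv ^^ Suc N) G ` cball 1 (1 / 2). norm v \<le> B"
    using compact_imp_bounded bounded_iff by metis
  then have B: "norm ((deriv ^^ Suc N) G q) \<le> B" if "q \<in> cball 1 (1 / 2)" for q
    using that by blast
  have "B \<ge> 0" using order.trans[OF norm_ge_zero B[of 1]] by simp
  define Q :: "complex poly" where "Q = (\<Sum>i\<le>N. smult ((deriv ^^ i) G 1 / fact i) ([:-1, 1:] ^ i))"
  have Q: "poly Q q = (\<Sum>i\<le>N. (deriv ^^ i) G 1 * (q - 1) ^ i / fact i)" for q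
    by (simp add: Q_def poly_sum)
  show ?thesis
  proof (rule that[of Q "B * (2 * pi) ^ Suc N / fact N"])
    \<comment> \<open>Since \<open>2 * pi < 8\<close>, this range keeps
      \<open>cis (- 2 * pi * u)\<close> within 1/2 of 1, where the derivative bound \<open>B\<close>
      holds, and on the principal branch of the logarithm.\<close>
    fix u :: real assume u: "\<bar>u\<bar> < 1 / 16"
    let ?q = "cis (- 2 * pi * u)"
    have "\<bar>2 * pi * u\<bar> < 1 / 2"
    proof -
      have "2 * pi * \<bar>u\<bar> \<le> 8 * \<bar>u\<bar>" using pi_less_4 by (intro mult_right_mono) auto
      then show ?thesis using u by (simp add: abs_mult)
    qed
    moreover have q1: "norm (?q - 1) \<le> \<bar>2 * pi * u\<bar>"
      using norm_cis_minus_one_le[of "- 2 * pi * u"] by simp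
    ultimately have qb: "?q \<in> ball 1 (1 / 2)" by (simp add: dist_norm norm_minus_commute)
    have "- pi < - 2 * pi * u" "- 2 * pi * u \<le> pi"
      using \<open>\<bar>2 * pi * u\<bar> < 1 / 2\<close> pi_ge_two by linarith+
    then have "Ln ?q = \<i> * of_real (- 2 * pi * u)"
      unfolding cis_conv_exp by (intro Ln_exp) auto
    then have G: "G ?q = poly P (of_real u)"
      by (simp add: G_def)
    have "norm ((deriv ^^ 0) G ?q - (\<Sum>i\<le>N. (deriv ^^ i) G 1 * (?q - 1) ^ i / fact i)) \<le> B * norm (?q - 1) ^ Suc N / fact N"
    proof (rule complex_Taylor[of "ball 1 (1 / 2)"])
      fix i w assume "w \<in> ball (1::complex) (1 / 2)"
      then have "w \<in> ball 1 1" by auto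
      then show "((deriv ^^ i) G has_field_derivative (deriv ^^ Suc i) G w) (at w within ball 1 (1 / 2))"
        by (intro DERIV_subset[OF has_field_derivative_higher_deriv[OF hol]]) auto
    next
      fix w assume "w \<in> ball (1::complex) (1 / 2)"
      then show "norm ((deriv ^^ Suc N) G w) \<le> B" by (intro B) auto
    qed (use qb in auto)
    also have "\<dots> \<le> B * \<bar>2 * pi * u\<bar> ^ Suc N / fact N"
      using q1 \<open>B \<ge> 0\<close> by (intro divide_right_mono mult_left_mono power_mono) auto
    also have "\<bar>2 * pi * u\<bar> = 2 * pi * \<bar>u\<bar>"
      by (simp add: abs_mult)
    finally show "norm (poly P (of_real u) - poly Q ?q) \<le> B * (2 * pi) ^ Suc N / fact N * \<bar>u\<bar> ^ Suc N"
      unfolding Q funpow_0 G by (simp only: power_mult_distrib times_divide_eq_left mult.assoc)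
  qed
qed

text \<open>Near \<open>x\<close> the Hoelder polynomial is exchanged for \<open>Q\<close>; away
  from \<open>x\<close> both functions are bounded and \<open>\<bar>t - x\<bar>\<close> is bounded
  below, so the local bound becomes global. The freedom to lower the exponent to
  \<open>\<beta>'\<close> is used later to stay below \<open>s\<close>.\<close>

lemma hoelder_at_trig_approx:
  fixes f :: "real \<Rightarrow> complex"
  assumes f: "hoelder_at \<beta> f x" and B: "\<And>t. norm (f t) \<le> B" and \<beta>: "0 < \<beta>'" "\<beta>' \<le> \<beta>"
  obtains Q :: "complex poly" and C where "C > 0"
    "\<And>t. t \<noteq> x \<Longrightarrow> norm (f t - poly Q (cis (- 2 * pi * (t - x)))) \<le> C * \<bar>t - x\<bar> powr \<beta>'"
proof -
  obtain P C1 where P: "\<forall>\<^sub>F t in at x. norm (f t - poly P (of_real (t - x))) \<le> C1 * \<bar>t - x\<bar> powr \<beta>"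
    using f unfolding hoelder_at_def by blast
  then obtain \<delta>1 where \<delta>1: "\<delta>1 > 0"
    "\<And>t. t \<noteq> x \<Longrightarrow> \<bar>t - x\<bar> < \<delta>1 \<Longrightarrow> norm (f t - poly P (of_real (t - x))) \<le> C1 * \<bar>t - x\<bar> powr \<beta>"
    by (auto simp: eventually_at dist_real_def)
  \<comment> \<open>The exchange error is of order \<open>Suc N \<ge> \<beta>\<close>, hence
    negligible for small \<open>\<bar>t - x\<bar>\<close>.\<close>
  define N where "N = nat \<lceil>\<beta>\<rceil>"
  have N: "\<beta> \<le> real (Suc N)" unfolding N_def by linarith
  obtain Q :: "complex poly" and C2 where Q:
    "\<And>u. \<bar>u\<bar> < 1 / 16 \<Longrightarrow> norm (poly P (of_real u) - poly Q (cis (- 2 * pi * u))) \<le> C2 * \<bar>u\<bar> ^ Suc N"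
    using poly_trig_approx by blast
  define \<delta> where "\<delta> = min \<delta>1 (1 / 16)"
  have \<delta>: "\<delta> > 0" using \<delta>1 by (simp add: \<delta>_def)
  define B' where "B' = B + (\<Sum>i\<le>degree Q. norm (coeff Q i))"
  have B': "norm (f t - poly Q (cis \<theta>)) \<le> B'" for t \<theta>
    unfolding B'_def by (rule order.trans[OF norm_triangle_ineq4 add_mono[OF B norm_poly_cis_le]])
  have B'0: "B' \<ge> 0" using order.trans[OF norm_ge_zero B'] .
  define C where "C = \<bar>C1\<bar> + \<bar>C2\<bar> + B' / \<delta> powr \<beta>' + 1"
  have C: "C > 0" "\<bar>C1\<bar> + \<bar>C2\<bar> \<le> C" "B' / \<delta> powr \<beta>' \<le> C"
    using divide_nonneg_nonneg[OF B'0, of "\<delta> powr \<beta>'"] unfolding C_def by simp_all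
  show ?thesis
  proof (rule that[OF C(1)])
    fix t assume t: "t \<noteq> x"
    define u where "u = t - x"
    have u: "\<bar>u\<bar> > 0" using t by (simp add: u_def)
    show "norm (f t - poly Q (cis (- 2 * pi * (t - x)))) \<le> C * \<bar>t - x\<bar> powr \<beta>'"
    proof (cases "\<bar>u\<bar> < \<delta>")
      case True
      then have u1: "\<bar>u\<bar> < \<delta>1" "\<bar>u\<bar> < 1 / 16" by (auto simp: \<delta>_def)
      have "\<bar>u\<bar> powr \<beta> \<le> \<bar>u\<bar> powr \<beta>'"
        using u u1 \<beta> by (intro powr_mono') auto
      then have "C1 * \<bar>u\<bar> powr \<beta> \<le> \<bar>C1\<bar> * \<bar>u\<bar> powr \<beta>'"
        by (intro mult_mono) auto
      moreover have "norm (f t - poly P (of_real u)) \<le> C1 * \<bar>u\<bar> powr \<beta>"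
        using \<delta>1(2)[OF t] u1 unfolding u_def by blast
      ultimately have 1: "norm (f t - poly P (of_real u)) \<le> \<bar>C1\<bar> * \<bar>u\<bar> powr \<beta>'"
        by linarith
      have "\<bar>u\<bar> ^ Suc N = \<bar>u\<bar> powr real (Suc N)"
        using powr_realpow[OF u, of "Suc N"] by simp
      also have "\<dots> \<le> \<bar>u\<bar> powr \<beta>'"
        using u u1 \<beta> N by (intro powr_mono') auto
      finally have "C2 * \<bar>u\<bar> ^ Suc N \<le> \<bar>C2\<bar> * \<bar>u\<bar> powr \<beta>'"
        by (intro mult_mono) auto
      then have 2: "norm (poly P (of_real u) - poly Q (cis (- 2 * pi * u))) \<le> \<bar>C2\<bar> * \<bar>u\<bar> powr \<beta>'"
        using Q[OF u1(2)] by linarith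
      have "norm (f t - poly Q (cis (- 2 * pi * u))) \<le> \<bar>C1\<bar> * \<bar>u\<bar> powr \<beta>' + \<bar>C2\<bar> * \<bar>u\<bar> powr \<beta>'"
        using 1 2 by (rule norm_diff_triangle_le)
      also have "\<dots> = (\<bar>C1\<bar> + \<bar>C2\<bar>) * \<bar>u\<bar> powr \<beta>'" by (simp add: distrib_right)
      also have "\<dots> \<le> C * \<bar>u\<bar> powr \<beta>'" by (intro mult_right_mono C) auto
      finally show ?thesis by (simp only: u_def)
    next
      case False
      have "norm (f t - poly Q (cis (- 2 * pi * (t - x)))) \<le> B' / \<delta> powr \<beta>' * \<delta> powr \<beta>'"
        using B' \<delta> by simp
      also have "\<dots> \<le> C * \<bar>u\<bar> powr \<beta>'"
        using False \<delta> \<beta> C by (intro mult_mono powr_mono2) auto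
      finally show ?thesis by (simp only: u_def)
    qed
  qed
qed

section \<open>The upper bound for the regularity\<close>

lemma integral_cone_powr_le:
  fixes c y p :: real
  assumes y: "y > 0" and p: "p > 0"
  defines "h \<equiv> \<lambda>t. (y + \<bar>t - c\<bar>) powr (- p - 1)"
  shows "integrable (lebesgue_on {c - 1 / 2..c - 1 / 2 + 1}) h"
    and "integral\<^sup>L (lebesgue_on {c - 1 / 2..c - 1 / 2 + 1}) h \<le> 2 * y powr (- p) / p"
proof -
  show int: "integrable (lebesgue_on {c - 1 / 2..c - 1 / 2 + 1}) h"
    unfolding h_def using y by (intro continuous_imp_integrable_real continuous_intros) auto
  define J where "J = (y powr (- p) - (y + 1 / 2) powr (- p)) / p"
  have "(h has_integral ((y + (c - c)) powr (- p) / p - (y + (c - (c - 1 / 2))) powr (- p) / p)) {c - 1 / 2..c}"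
  proof (rule fundamental_theorem_of_calculus)
    fix t assume t: "t \<in> {c - 1 / 2..c}"
    have "((\<lambda>t. (y + (c - t)) powr (- p) / p) has_real_derivative (y + (c - t)) powr (- p - 1)) (at t within {c - 1 / 2..c})"
      using t y p by (auto intro!: derivative_eq_intros simp: field_simps)
    moreover have "h t = (y + (c - t)) powr (- p - 1)" using t by (simp add: h_def)
    ultimately show "((\<lambda>t. (y + (c - t)) powr (- p) / p) has_vector_derivative h t) (at t within {c - 1 / 2..c})"
      by (simp add: has_real_derivative_iff_has_vector_derivative)
  qed auto
  then have 1: "(h has_integral J) {c - 1 / 2..c}"
    by (simp add: J_def diff_divide_distrib)
  have "(h has_integral (- ((y + (c + 1 / 2 - c)) powr (- p)) / p - (- ((y + (c - c)) powr (- p)) / p))) {c..c + 1 / 2}"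
  proof (rule fundamental_theorem_of_calculus)
    fix t assume t: "t \<in> {c..c + 1 / 2}"
    have "((\<lambda>t. - ((y + (t - c)) powr (- p)) / p) has_real_derivative (y + (t - c)) powr (- p - 1)) (at t within {c..c + 1 / 2})"
      using t y p by (auto intro!: derivative_eq_intros simp: field_simps)
    moreover have "h t = (y + (t - c)) powr (- p - 1)" using t by (simp add: h_def)
    ultimately show "((\<lambda>t. - ((y + (t - c)) powr (- p)) / p) has_vector_derivative h t) (at t within {c..c + 1 / 2})"
      by (simp add: has_real_derivative_iff_has_vector_derivative)
  qed auto
  then have 2: "(h has_integral J) {c..c + 1 / 2}"
    by (simp add: J_def diff_divide_distrib)
  have "(h has_integral (J + J)) {c - 1 / 2..c - 1 / 2 + 1}"
  proof -
    have "c - 1 / 2 + 1 = c + 1 / 2" by simp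
    show ?thesis unfolding \<open>c - 1 / 2 + 1 = c + 1 / 2\<close> using has_integral_combine[OF _ _ 1 2] by simp
  qed
  then have "integral\<^sup>L (lebesgue_on {c - 1 / 2..c - 1 / 2 + 1}) h = J + J"
    by (subst lebesgue_integral_eq_integral[OF int]) (auto intro: integral_unique)
  also have "\<dots> \<le> 2 * y powr (- p) / p"
    using p by (simp add: J_def field_simps)
  finally show "integral\<^sup>L (lebesgue_on {c - 1 / 2..c - 1 / 2 + 1}) h \<le> 2 * y powr (- p) / p" .
qed

text \<open>In the cone \<open>\<bar>t - x\<bar> \<le> (K + 1) * (Im z + \<bar>t - Re
  z\<bar>)\<close>, so the integrand of the kernel formula is bounded by a multiple of
  \<open>(Im z + \<bar>t - Re z\<bar>) powr (\<beta>' - s - 1)\<close>. As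
  \<open>\<beta>' < s\<close>, its integral has order \<open>Im z powr (\<beta>' - s)\<close>.
  Centring the period at \<open>Re z\<close> keeps \<open>z - t\<close> in the strip of the kernel
  bound.\<close>

lemma hoelder_at_imp_cone_bound:
  assumes F: "has_fourier_expansion M r" "r 0 = 0"
    and summable: "summable (\<lambda>n. norm (r (Suc n)) / real (Suc n) powr s)"
    and hoelder: "hoelder_at \<beta> (sine_series r s) x" and \<beta>: "0 < \<beta>'" "\<beta>' \<le> \<beta>" "\<beta>' < s"
    and K: "K \<ge> 0"
  obtains C where "C > 0" "\<And>z. z \<in> upper_half_plane \<Longrightarrow> \<bar>Re z - x\<bar> \<le> K * Im z \<Longrightarrow>
    norm (M z) \<le> C * Im z powr (\<beta>' - s)"
proof -
  have s: "s > 0" using \<beta> by simp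
  obtain B where B: "\<And>t. norm (sine_series r s t) \<le> B"
    using sine_series_bounded[OF summable] by blast
  obtain Q :: "complex poly" and C1 where Q: "C1 > 0"
    "\<And>t. t \<noteq> x \<Longrightarrow> norm (sine_series r s t - poly Q (cis (- 2 * pi * (t - x)))) \<le> C1 * \<bar>t - x\<bar> powr \<beta>'"
    using hoelder_at_trig_approx[OF hoelder B \<beta>(1,2)] by blast
  obtain C2 where C2: "C2 > 0" "\<And>w. \<bar>Re w\<bar> \<le> 1 / 2 \<Longrightarrow> Im w > 0 \<Longrightarrow>
    norm (frac_kernel s w) \<le> C2 * norm w powr (- s - 1)"
    using frac_kernel_bound[OF s] by blast
  define p where "p = s - \<beta>'"
  have p: "p > 0" using \<beta> by (simp add: p_def)
  define D where "D = C1 * (K + 1) powr \<beta>' * (C2 * 2 powr (s + 1))"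
  have D: "D > 0" using Q C2 K by (simp add: D_def)
  define g where "g t = sine_series r s t - poly Q (cis (- 2 * pi * (t - x)))" for t
  show ?thesis
  proof (rule that[of "2 * (D * (2 / p))"])
    show "2 * (D * (2 / p)) > 0" using D p by simp
    fix z assume z: "z \<in> upper_half_plane" "\<bar>Re z - x\<bar> \<le> K * Im z"
    define y where "y = Im z"
    define c where "c = Re z"
    have y: "y > 0" using z by (simp add: y_def upper_half_plane_def)
    let ?I = "lebesgue_on {c - 1 / 2..c - 1 / 2 + 1}"
    have int: "integrable ?I (\<lambda>t. g t * frac_kernel s (z - of_real t))"
      and Mz: "M z = 2 * \<i> * integral\<^sup>L ?I (\<lambda>t. g t * frac_kernel s (z - of_real t))"
      unfolding g_def by (rule fourier_form_eq_kernel_integral[OF F s summable z(1)])+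
    have pointwise: "norm (g t * frac_kernel s (z - of_real t)) \<le> D * (y + \<bar>t - c\<bar>) powr (- p - 1)"
      if t: "t \<in> {c - 1 / 2..c - 1 / 2 + 1}" "t \<noteq> x" for t
    proof -
      define b where "b = y + \<bar>t - c\<bar>"
      have b: "b > 0" using y by (simp add: b_def)
      have "\<bar>t - x\<bar> \<le> \<bar>t - c\<bar> + K * y"
        using z(2) by (simp add: y_def c_def)
      also have "\<dots> \<le> (K + 1) * b"
        using K y mult_nonneg_nonneg[OF K abs_ge_zero[of "t - c"]] by (simp add: b_def algebra_simps)
      finally have "\<bar>t - x\<bar> powr \<beta>' \<le> ((K + 1) * b) powr \<beta>'"
        using \<beta> by (intro powr_mono2) auto
      then have "C1 * \<bar>t - x\<bar> powr \<beta>' \<le> C1 * ((K + 1) * b) powr \<beta>'"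
        using Q(1) by (intro mult_left_mono) auto
      also have "\<dots> = C1 * (K + 1) powr \<beta>' * b powr \<beta>'"
        using K b by (simp add: powr_mult)
      finally have 1: "norm (g t) \<le> C1 * (K + 1) powr \<beta>' * b powr \<beta>'"
        using Q(2)[OF t(2)] by (simp add: g_def)
      let ?w = "z - of_real t"
      have "y \<le> norm ?w" "\<bar>t - c\<bar> \<le> norm ?w"
        using abs_Im_le_cmod[of ?w] abs_Re_le_cmod[of ?w] by (auto simp: y_def c_def)
      then have "b / 2 \<le> norm ?w" by (simp add: b_def)
      then have "norm ?w powr (- s - 1) \<le> (b / 2) powr (- s - 1)"
        using b s by (intro powr_mono2') auto
      also have "\<dots> = 2 powr (s + 1) * b powr (- s - 1)"
        using b by (simp add: powr_divide powr_minus_divide[of _ "s + 1", simplified] powr_diff powr_minus powr_add field_simps)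
      finally have "C2 * norm ?w powr (- s - 1) \<le> C2 * (2 powr (s + 1) * b powr (- s - 1))"
        using C2(1) by (intro mult_left_mono) auto
      moreover have "norm (frac_kernel s ?w) \<le> C2 * norm ?w powr (- s - 1)"
      proof (rule C2(2))
        have "\<bar>c - t\<bar> \<le> 1 / 2" using t(1) unfolding abs_le_iff by auto
        then show "\<bar>Re ?w\<bar> \<le> 1 / 2" by (simp add: c_def)
        show "Im ?w > 0" using y by (simp add: y_def)
      qed
      ultimately have 2: "norm (frac_kernel s ?w) \<le> C2 * (2 powr (s + 1) * b powr (- s - 1))"
        by linarith
      have "norm (g t * frac_kernel s ?w) \<le> (C1 * (K + 1) powr \<beta>' * b powr \<beta>') * (C2 * (2 powr (s + 1) * b powr (- s - 1)))"
        unfolding norm_mult using Q(1) by (intro mult_mono 1 2) auto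
      also have "\<dots> = D * (b powr \<beta>' * b powr (- s - 1))"
        by (simp add: D_def)
      also have "b powr \<beta>' * b powr (- s - 1) = b powr (- p - 1)"
        by (simp add: powr_add[symmetric] p_def algebra_simps)
      finally show ?thesis by (simp add: b_def)
    qed
    \<comment> \<open>The point \<open>t = x\<close>, about which the Hoelder condition says
      nothing, is a null set.\<close>
    have AE: "AE t in ?I. norm (g t * frac_kernel s (z - of_real t)) \<le> D * (y + \<bar>t - c\<bar>) powr (- p - 1)"
    proof -
      have "AE t in lebesgue. t \<noteq> x"
        by (rule AE_completion[OF AE_lborel_singleton])
      then have "AE t in lebesgue. t \<in> {c - 1 / 2..c - 1 / 2 + 1} \<longrightarrow>
          norm (g t * frac_kernel s (z - of_real t)) \<le> D * (y + \<bar>t - c\<bar>) powr (- p - 1)"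
        by (rule AE_mp) (auto intro!: AE_I2 pointwise)
      then show ?thesis
        by (subst AE_restrict_space_iff) auto
    qed
    have "norm (M z) = 2 * norm (integral\<^sup>L ?I (\<lambda>t. g t * frac_kernel s (z - of_real t)))"
      unfolding Mz by (simp add: norm_mult)
    also have "norm (integral\<^sup>L ?I (\<lambda>t. g t * frac_kernel s (z - of_real t)))
        \<le> integral\<^sup>L ?I (\<lambda>t. norm (g t * frac_kernel s (z - of_real t)))"
      by (rule integral_norm_bound)
    also have "\<dots> \<le> integral\<^sup>L ?I (\<lambda>t. D * (y + \<bar>t - c\<bar>) powr (- p - 1))"
      by (rule integral_mono_AE[OF integrable_norm[OF int] _ AE])
        (intro integrable_mult_right integral_cone_powr_le(1)[OF y p])
    also have "\<dots> = D * integral\<^sup>L ?I (\<lambda>t. (y + \<bar>t - c\<bar>) powr (- p - 1))"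
      by simp
    also have "\<dots> \<le> D * (2 * y powr (- p) / p)"
      using D by (intro mult_left_mono integral_cone_powr_le(2)[OF y p]) auto
    finally show "norm (M z) \<le> 2 * (D * (2 / p)) * Im z powr (\<beta>' - s)"
      by (simp add: y_def p_def)
  qed
qed

text \<open>A rational \<open>h / q\<close> within \<open>1 / q\<^sup>2\<close> of \<open>x\<close>
  is completed to a matrix with first column \<open>(h, q)\<close>. With
  \<open>j = q * w + v\<close>, the image of \<open>w\<close> lies at distance
  \<open>1 / (q * norm j)\<close> from \<open>h / q\<close> and at height
  \<open>Im w / (norm j)\<^sup>2\<close>. As \<open>norm j\<close> is at most a constant times
  \<open>q\<close>, both horizontal errors are comparable to the height. Large \<open>q\<close>
  exist because \<open>x\<close> is irrational.\<close>

lemma irrational_moebius_cone: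
  assumes x: "x \<notin> \<rat>" and w: "w \<in> upper_half_plane"
  obtains K where "K \<ge> 0" "\<And>N::nat. \<exists>a b c d :: int. a * d - b * c = 1 \<and> int N < c \<and>
    \<bar>Re ((of_int a * w + of_int b) / (of_int c * w + of_int d)) - x\<bar>
      \<le> K * Im ((of_int a * w + of_int b) / (of_int c * w + of_int d))"
proof -
  define m where "m = norm w + 1"
  have y: "Im w > 0" using w by (simp add: upper_half_plane_def)
  have m: "m > 0" by (simp add: m_def add_nonneg_pos)
  define K where "K = (m + m\<^sup>2) / Im w"
  show ?thesis
  proof (rule that[of K])
    show "K \<ge> 0" using m y by (simp add: K_def)
    fix N :: nat
    have "infinite (approx_set x)" using x rational_iff_finite_approx_set by blast
    then obtain h q where hq: "(h, q) \<in> approx_set x" "q > int N"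
      using infinite_approx_set by blast
    then have q: "q > 0" "coprime h q" "\<bar>x - of_int h / of_int q\<bar> < 1 / (of_int q)\<^sup>2"
      by (auto simp: approx_set_def)
    obtain a b where ab: "a * h + b * q = 1"
      using q(2) bezout_int[of h q] by auto
    \<comment> \<open>The Bezout coefficient is fixed only modulo \<open>q\<close>; the reduced
      choice yields \<open>norm j \<le> q * (norm w + 1)\<close>, which makes \<open>K\<close>
      independent of the approximation.\<close>
    define v where "v = a mod q"
    define u where "u = - (b + (a div q) * h)"
    have v: "0 \<le> v" "v \<le> q" using q(1) by (auto simp: v_def order_less_imp_le)
    have det: "h * v - u * q = 1"
    proof -
      have "a = q * (a div q) + v" by (simp add: v_def)
      then have "h * v = h * a - h * q * (a div q)" by (metis add_diff_cancel_left' mult.assoc right_diff_distrib)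
      then show ?thesis using ab by (simp add: u_def algebra_simps)
    qed
    define j where "j = of_int q * w + of_int v"
    let ?z = "(of_int h * w + of_int u) / (of_int q * w + of_int v)"
    have j0: "j \<noteq> 0" unfolding j_def by (rule moebius_upper_half_plane(1)[OF det w])
    have qr: "real_of_int q > 0" using q by simp
    have "norm j \<le> of_int q * norm w + of_int v"
      unfolding j_def using norm_triangle_ineq[of "of_int q * w" "of_int v"] q(1) v by (simp add: norm_mult)
    also have "\<dots> \<le> of_int q * m"
      using v by (simp add: m_def distrib_left)
    finally have jm: "norm j / of_int q \<le> m"
      using qr by (simp add: pos_divide_le_eq mult.commute)
    have "?z - of_int h / of_int q = - (of_int (h * v - u * q)) / (of_int q * j)"
      using j0 q(1) unfolding j_def by (simp add: field_simps)
    then have "norm (?z - of_int h / of_int q) = 1 / (of_int q * norm j)"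
      unfolding det using q(1) by (simp add: norm_divide norm_mult)
    moreover have "\<bar>Re ?z - of_int h / of_int q\<bar> \<le> norm (?z - of_int h / of_int q)"
    proof -
      have "complex_of_int h / of_int q = of_real (of_int h / of_int q)" by simp
      then show ?thesis
        using abs_Re_le_cmod[of "?z - of_int h / of_int q"] by (simp only: minus_complex.sel Re_complex_of_real)
    qed
    ultimately have "\<bar>Re ?z - x\<bar> \<le> 1 / (of_int q * norm j) + 1 / (of_int q)\<^sup>2"
      using q(3) by linarith
    also have "\<dots> = (norm j / of_int q + (norm j / of_int q)\<^sup>2) / (norm j)\<^sup>2"
      using j0 q(1) by (simp add: field_simps power2_eq_square)
    also have "\<dots> \<le> (m + m\<^sup>2) / (norm j)\<^sup>2"
      using jm qr by (intro divide_right_mono add_mono power_mono) auto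
    also have "\<dots> = K * Im ?z"
    proof -
      have "Im ?z = Im w / (norm j)\<^sup>2"
        unfolding j_def by (rule moebius_upper_half_plane(2)[OF det w])
      then show ?thesis unfolding K_def using y by (simp only:) simp
    qed
    finally show "\<exists>a b c d :: int. a * d - b * c = 1 \<and> int N < c \<and>
      \<bar>Re ((of_int a * w + of_int b) / (of_int c * w + of_int d)) - x\<bar>
      \<le> K * Im ((of_int a * w + of_int b) / (of_int c * w + of_int d))"
      using det hq(2) by blast
  qed
qed

text \<open>The images of \<open>w\<close> in the cone have height tending to 0 as their lower left
  entry grows, and the invariant function is at most a constant times the height to the power
  \<open>\<eta>\<close> there. Its value at \<open>w\<close> is therefore 0. The aperture
  \<open>K\<close> depends on \<open>w\<close>, hence decay is required in every cone.\<close>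

lemma modular_form_cone_decay_imp_zero:
  assumes M: "modular_form k M" and x: "x \<notin> \<rat>" and \<eta>: "\<eta> > 0"
    and decay: "\<And>K. K \<ge> 0 \<Longrightarrow> \<exists>C. \<forall>z\<in>upper_half_plane. \<bar>Re z - x\<bar> \<le> K * Im z \<longrightarrow>
      norm (M z) \<le> C * Im z powr (\<eta> - real k / 2)"
    and w: "w \<in> upper_half_plane"
  shows "M w = 0"
proof -
  have y: "Im w > 0" using w by (simp add: upper_half_plane_def)
  obtain K where K: "K \<ge> 0" "\<And>N::nat. \<exists>a b c d :: int. a * d - b * c = 1 \<and> int N < c \<and>
    \<bar>Re ((of_int a * w + of_int b) / (of_int c * w + of_int d)) - x\<bar>
      \<le> K * Im ((of_int a * w + of_int b) / (of_int c * w + of_int d))"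
    using irrational_moebius_cone[OF x w] by blast
  obtain C where C: "\<And>z. z \<in> upper_half_plane \<Longrightarrow> \<bar>Re z - x\<bar> \<le> K * Im z \<Longrightarrow>
      norm (M z) \<le> C * Im z powr (\<eta> - real k / 2)"
    using decay[OF K(1)] by blast
  have bound: "Im w powr (real k / 2) * norm (M w) \<le> \<bar>C\<bar> * (1 / (real (Suc N) * Im w)) powr \<eta>" for N :: nat
  proof -
    obtain a b c d :: int where *: "a * d - b * c = 1" "int (Suc N) < c"
      and cone: "\<bar>Re ((of_int a * w + of_int b) / (of_int c * w + of_int d)) - x\<bar>
        \<le> K * Im ((of_int a * w + of_int b) / (of_int c * w + of_int d))"
      using K(2)[of "Suc N"] by blast
    define z where "z = (of_int a * w + of_int b) / (of_int c * w + of_int d)"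
    define j where "j = of_int c * w + of_int d"
    have zH: "z \<in> upper_half_plane" unfolding z_def by (rule moebius_upper_half_plane(3)[OF *(1) w])
    then have z0: "Im z > 0" by (simp add: upper_half_plane_def)
    have Imz: "Im z = Im w / (norm j)\<^sup>2"
      unfolding z_def j_def by (rule moebius_upper_half_plane(2)[OF *(1) w])
    have "real (Suc N) \<le> of_int c" using *(2) by linarith
    then have "real (Suc N) * Im w \<le> of_int c * Im w" using y by (intro mult_right_mono) auto
    also have "\<dots> \<le> norm j" using abs_Im_le_cmod[of j] by (simp add: j_def)
    finally have jN: "real (Suc N) * Im w \<le> norm j" .
    have N1: "0 < real (Suc N) * Im w" using y by simp
    have "(real (Suc N) * Im w)\<^sup>2 \<le> (norm j)\<^sup>2" using jN N1 by (intro power_mono) auto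
    then have "Im z \<le> Im w / (real (Suc N) * Im w)\<^sup>2"
      unfolding Imz using y N1 jN by (intro divide_left_mono mult_pos_pos zero_less_power) linarith+
    also have "\<dots> = 1 / (real (Suc N) * Im w) * (1 / real (Suc N))"
      using y by (simp add: power2_eq_square)
    also have "\<dots> \<le> 1 / (real (Suc N) * Im w) * 1"
      using y by (intro mult_left_mono) auto
    finally have Imz_le: "Im z \<le> 1 / (real (Suc N) * Im w)" by simp
    have "Im w powr (real k / 2) * norm (M w) = Im z powr (real k / 2) * norm (M z)"
      unfolding z_def by (rule modular_form_norm_invariant[OF M *(1) w, symmetric])
    also have "\<dots> \<le> Im z powr (real k / 2) * (\<bar>C\<bar> * Im z powr (\<eta> - real k / 2))"
    proof (rule mult_left_mono)
      have "norm (M z) \<le> C * Im z powr (\<eta> - real k / 2)"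
        using C[OF zH] cone unfolding z_def by blast
      also have "\<dots> \<le> \<bar>C\<bar> * Im z powr (\<eta> - real k / 2)" by (intro mult_right_mono) auto
      finally show "norm (M z) \<le> \<bar>C\<bar> * Im z powr (\<eta> - real k / 2)" .
    qed auto
    also have "\<dots> = \<bar>C\<bar> * (Im z powr (real k / 2) * Im z powr (\<eta> - real k / 2))"
      by (simp only: mult_ac)
    also have "Im z powr (real k / 2) * Im z powr (\<eta> - real k / 2) = Im z powr \<eta>"
      by (simp add: powr_add[symmetric])
    also have "Im z powr \<eta> \<le> (1 / (real (Suc N) * Im w)) powr \<eta>"
      using z0 \<eta> Imz_le by (intro powr_mono2) auto
    finally show ?thesis
      by (simp add: mult_left_mono)
  qed
  have lim: "(\<lambda>N. \<bar>C\<bar> * (1 / (real (Suc N) * Im w)) powr \<eta>) \<longlonglongrightarrow> 0"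
  proof -
    have "filterlim (\<lambda>N. real (Suc N) * Im w) at_top sequentially"
      using y by (intro filterlim_at_top_mult_tendsto_pos[OF tendsto_const] filterlim_compose[OF filterlim_real_sequentially filterlim_Suc]) auto
    then have "(\<lambda>N. (real (Suc N) * Im w) powr (- \<eta>)) \<longlonglongrightarrow> 0"
      using \<eta> by (intro tendsto_neg_powr) auto
    then have "(\<lambda>N. \<bar>C\<bar> * (real (Suc N) * Im w) powr (- \<eta>)) \<longlonglongrightarrow> 0"
      by (rule tendsto_mult_right_zero)
    then show ?thesis by (simp add: powr_minus_divide powr_divide del: of_nat_Suc)
  qed
  have "Im w powr (real k / 2) * norm (M w) \<le> 0"
    by (rule LIMSEQ_le_const[OF lim]) (use bound in auto)
  moreover have "Im w powr (real k / 2) > 0" using y by simp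
  ultimately show ?thesis by (simp add: mult_le_0_iff)
qed

theorem theorem1p3:
  fixes k :: nat and M :: "complex \<Rightarrow> complex" and r :: "nat \<Rightarrow> complex" and s x :: real
  assumes "k \<ge> 4" and "even k"
    and "cusp_form k M r"
    and "x \<notin> \<rat>"
    and "ereal s > ereal (real k / 2 + 1) + 2 / nu_exponent x - 2 / mu_exponent x"
  shows "hoelder_exponent (sine_series r s) x \<ge> ereal (s - real k / 2 - 1) + 2 / mu_exponent x
    \<and> ((\<exists>z\<in>upper_half_plane. M z \<noteq> 0) \<and>
        (\<exists>N::nat. infinite {n. partial_quotient x n = int N}) \<and> mu_exponent x = 2
        \<longrightarrow> hoelder_exponent (sine_series r s) x = ereal (s - real k / 2))"
proof -
  define \<kappa> where "\<kappa> = real k / 2"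
  have \<kappa>: "\<kappa> \<ge> 2" using assms(1) by (simp add: \<kappa>_def)
  have mf: "modular_form k M" and F: "has_fourier_expansion M r" "r 0 = 0"
    using assms(3) by (auto simp: cusp_form_def)
  have hol: "M holomorphic_on upper_half_plane"
    using mf by (simp add: modular_form_def)
  note nu = nu_mu_exponent(1)[OF assms(4)] and nu_mu = nu_mu_exponent(2)[OF assms(4)]
  obtain m where m: "2 / mu_exponent x = ereal m" "0 \<le> m" "m \<le> 1"
    using ereal_two_divide[OF order.trans[OF nu nu_mu]] by blast
  obtain n where n: "2 / nu_exponent x = ereal n" "0 \<le> n" "n \<le> 1"
    using ereal_two_divide[OF nu] by blast
  \<comment> \<open>The difference of the two fractions in the hypothesis is nonnegative, so
    \<open>s > \<kappa> + 1\<close>; this makes \<open>n powr (\<kappa> - s)\<close>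
    summable.\<close>
  have "m \<le> n"
    using ereal_two_divide_antimono[OF nu nu_mu] m n by simp
  then have s: "s > \<kappa> + 1"
    using assms(5) m n by (simp add: \<kappa>_def)
  obtain C where C: "C > 0"
    and growth: "\<forall>z\<in>upper_half_plane. norm (M z) \<le> C * Im z powr (- \<kappa>) * exp (- Im z)"
    using cusp_form_growth[OF assms(3)] unfolding \<kappa>_def minus_divide_left by blast
  obtain C' where C': "C' > 0" "\<And>n. norm (r (Suc n)) \<le> C' * real (Suc n) powr \<kappa>"
    using fourier_coefficient_bound[OF F C growth] by blast
  have summable: "summable (\<lambda>n. norm (r (Suc n)) / real (Suc n) powr s)"
  proof (rule summable_comparison_test'[where N = 0])
    have "summable (\<lambda>n. real n powr (\<kappa> - s))"
      using s by (subst summable_real_powr_iff) auto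
    then have "summable (\<lambda>n. real (Suc n) powr (\<kappa> - s))"
      by (subst summable_Suc_iff)
    then show "summable (\<lambda>n. C' * real (Suc n) powr (\<kappa> - s))"
      by (rule summable_mult)
    fix n :: nat
    show "norm (norm (r (Suc n)) / real (Suc n) powr s) \<le> C' * real (Suc n) powr (\<kappa> - s)"
      using divide_right_mono[OF C'(2)[of n], of "real (Suc n) powr s"] by (simp add: powr_diff)
  qed
  have lower: "ereal (s - \<kappa>) \<le> hoelder_exponent (sine_series r s) x"
  proof (rule dense_le)
    fix e assume e: "e < ereal (s - \<kappa>)"
    \<comment> \<open>Only positive exponents occur in the supremum, so a small or infinite
      \<open>e\<close> is replaced by \<open>(s - \<kappa>) / 2\<close>.\<close>
    obtain \<beta> where \<beta>: "0 < \<beta>" "\<beta> < s - \<kappa>" "e \<le> ereal \<beta>"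
    proof (cases e)
      case (real c)
      then show ?thesis using that[of "max c ((s - \<kappa>) / 2)"] e s by (auto simp: less_max_iff_disj)
    qed (use that[of "(s - \<kappa>) / 2"] e s in auto)
    have "hoelder_at \<beta> (sine_series r s) x"
      by (rule sine_series_hoelder_at[OF F summable hol C _ growth \<beta>(1,2)]) (use \<kappa> in auto)
    then have "ereal \<beta> \<le> hoelder_exponent (sine_series r s) x"
      unfolding hoelder_exponent_def using \<beta>(1) by (intro Sup_upper) auto
    with \<beta>(3) show "e \<le> hoelder_exponent (sine_series r s) x" by (rule order.trans)
  qed
  have upper: "hoelder_exponent (sine_series r s) x \<le> ereal (s - \<kappa>)" if nz: "\<exists>z\<in>upper_half_plane. M z \<noteq> 0"
    unfolding hoelder_exponent_def
  proof (rule Sup_least)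
    fix e assume "e \<in> {ereal \<beta> |\<beta>. 0 < \<beta> \<and> hoelder_at \<beta> (sine_series r s) x}"
    then obtain \<beta> where \<beta>: "e = ereal \<beta>" "0 < \<beta>" "hoelder_at \<beta> (sine_series r s) x" by blast
    have "\<not> \<beta> > s - \<kappa>"
    proof
      assume gt: "\<beta> > s - \<kappa>"
      \<comment> \<open>The exponent is lowered strictly below \<open>s\<close>, as the cone bound
        requires, while staying above \<open>s - \<kappa>\<close>.\<close>
      define \<beta>' where "\<beta>' = min \<beta> (s - \<kappa> / 2)"
      have \<beta>': "0 < \<beta>'" "\<beta>' \<le> \<beta>" "\<beta>' < s" "\<beta>' > s - \<kappa>"
        using gt \<kappa> s \<beta>(2) by (auto simp: \<beta>'_def)
      have "M w = 0" if "w \<in> upper_half_plane" for w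
      proof (rule modular_form_cone_decay_imp_zero[OF mf assms(4) _ _ that])
        show "\<beta>' - (s - \<kappa>) > 0" using \<beta>'(4) by simp
        fix K :: real assume K: "K \<ge> 0"
        have exponent: "\<beta>' - (s - \<kappa>) - real k / 2 = \<beta>' - s" by (simp add: \<kappa>_def)
        obtain C0 where "\<And>z. z \<in> upper_half_plane \<Longrightarrow> \<bar>Re z - x\<bar> \<le> K * Im z \<Longrightarrow>
            norm (M z) \<le> C0 * Im z powr (\<beta>' - s)"
          using hoelder_at_imp_cone_bound[OF F summable \<beta>(3) \<beta>'(1-3) K] by blast
        then show "\<exists>C. \<forall>z\<in>upper_half_plane. \<bar>Re z - x\<bar> \<le> K * Im z \<longrightarrow>
            norm (M z) \<le> C * Im z powr (\<beta>' - (s - \<kappa>) - real k / 2)"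
          unfolding exponent by blast
      qed
      with nz show False by blast
    qed
    then show "e \<le> ereal (s - \<kappa>)" using \<beta>(1) by simp
  qed
  \<comment> \<open>This is \<open>m \<le> 1\<close>, that is,
    \<open>mu_exponent x \<ge> 2\<close>.\<close>
  have "ereal (s - real k / 2 - 1) + 2 / mu_exponent x \<le> ereal (s - \<kappa>)"
    using m by (simp add: \<kappa>_def)
  with lower have "ereal (s - real k / 2 - 1) + 2 / mu_exponent x \<le> hoelder_exponent (sine_series r s) x"
    by (rule order.trans[rotated])
  moreover have "hoelder_exponent (sine_series r s) x = ereal (s - real k / 2)"
    if "\<exists>z\<in>upper_half_plane. M z \<noteq> 0"
    using upper[OF that] lower unfolding \<kappa>_def by (rule antisym)
  ultimately show ?thesis by blast
qed

end
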